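(* Let $X$ be a finite set with $|X|\ge 5$. Then the edge-product space $\mathcal{E}(X)$, equipped with its Moulton–Steel regular CW decomposition (whose face poset, with the empty face $\hat 0$ included, is isomorphic to $S(X)\cup\{\hat 0\}$), is not shellable.
   Context: Let $X$ be a finite set. For a tree $T$ whose leaves are labeled bijectively by $X$, and for $\lambda:E(T)\to[0,1]$, define $f_{(T,\lambda)}:\binom{X}{2}\to[0,1]$ by $f_{(T,\lambda)}(\{x,y\})=\prod_{e\in p_{xy}}\lambda(e)$, where $p_{xy}$ is the set of edges on the path in $T$ between the leaves labeled $x$ and $y$. Let $\Lambda_T:[0,1]^{E(T)}\to[0,1]^{\binom{X}{2}}$ send $\lambda$ to the vector $(f_{(T,\lambda)}(\{x,y\}))$. The edge-product space is $\mathcal{E}(X)=\bigcup_T \Lambda_T([0,1]^{E(T)})$, the union over all trees $T$ with leaves labeled bijectively by $X$. An $X$-tree is a pair $(T,\phi)$ with $T$ a finite tree and $\phi:X\to V(T)$ a map such that every vertex not in $\phi(X)$ has degree at least $3$; a vertex is labeled if it lies in $\phi(X)$. An $X$-forest is a set $\{(A,\mathcal T_A):A\in\pi\}$ where $\pi$ is a set partition of $X$ and each $\mathcal T_A$ is an $A$-tree. Contracting an edge $e=(u,v)$ removes $e$ and identifies $u,v$, the new vertex carrying the union of the labels of $u$ and $v$. Deleting $e$ removes $e$ without changing vertices; the deletion is safe if each of $u$ and $v$ is labeled or has degree greater than $3$. The Tuffley poset $S(X)$ is the set of $X$-forests ordered by $\mathcal F'\le\mathcal F$ iff $\mathcal F'$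 is obtained from $\mathcal F$ by a sequence of contractions and safe deletions. Moulton and Steel showed $\mathcal E(X)$ has a finite CW decomposition (shown regular by Gill–Linusson–Moulton–Steel) whose face poset (closed cells ordered by containment, with a minimum $\hat0$ for the empty face adjoined) is isomorphic to $S(X)\cup\{\hat 0\}$; this is the cell structure meant. Its maximal cells correspond to trees whose leaves are labeled bijectively by $X$ and whose internal vertices are unlabeled of degree $3$. Shellability (Björner): a finite regular CW complex $\mathcal K$ all of whose facets have dimension $d$ is shellable if $d=0$, or $d>0$ and there is an ordering $f_1,\dots,f_n$ of its $d$-cells such that (1) each boundary complex $\partial f_i$ (the subcomplex of proper faces of $f_i$) is shellable; (2) for $j\ge2$, $\partial f_j\cap\bigcup_{i<j}\partial f_i$ is a regular CW complex all of whose facets have dimension $d-1$; (3) for $j\ge 2$, $\partial f_j$ has a shelling in which the $(d-1)$-cells of $\partial f_j\cap\bigcup_{i<j}\partial f_i$ come first. *)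

theory Defs
  imports Main
begin

text \<open>A regular CW complex is represented by its set of (nonempty) cells C together with
the face relation le (le g f iff the closed cell g is contained in the closed cell f).
The empty face is not an element of C.  The dimension of a cell is the length of a longest
strict chain of cells ending in it (this is the dimension of the cell in a regular CW
complex).  Subcomplexes are down-closed subsets of C.\<close>

definition cell_dim :: "'a set \<Rightarrow> ('a \<Rightarrow> 'a \<Rightarrow> bool) \<Rightarrow> 'a \<Rightarrow> nat" where
  "cell_dim C le f =
     Max {length cs | cs. cs \<noteq> [] \<and> set cs \<subseteq> C \<and>
                          sorted_wrt (\<lambda>a b. le a b \<and> a \<noteq> b) cs \<and> last cs = f} - 1"

definition cells_of :: "'a set \<Rightarrow> ('a \<Rightarrow> 'a \<Rightarrow> bool) \<Rightarrow> 'a set \<Rightarrow> nat \<Rightarrow> 'a set" where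
  "cells_of C le K d = {f \<in> K. cell_dim C le f = d}"

definition pure_dim :: "'a set \<Rightarrow> ('a \<Rightarrow> 'a \<Rightarrow> bool) \<Rightarrow> 'a set \<Rightarrow> nat \<Rightarrow> bool" where
  "pure_dim C le K d \<longleftrightarrow>
     (\<forall>f\<in>K. (\<forall>g\<in>K. le f g \<longrightarrow> g = f) \<longrightarrow> cell_dim C le f = d)"

definition bdry :: "'a set \<Rightarrow> ('a \<Rightarrow> 'a \<Rightarrow> bool) \<Rightarrow> 'a \<Rightarrow> 'a set" where
  "bdry C le f = {g \<in> C. le g f \<and> g \<noteq> f}"

inductive shelling :: "'a set \<Rightarrow> ('a \<Rightarrow> 'a \<Rightarrow> bool) \<Rightarrow> 'a set \<Rightarrow> nat \<Rightarrow> 'a list \<Rightarrow> bool"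
  for C :: "'a set" and le :: "'a \<Rightarrow> 'a \<Rightarrow> bool" where
  zero: "\<lbrakk> pure_dim C le K 0; distinct fs; set fs = cells_of C le K 0 \<rbrakk>
         \<Longrightarrow> shelling C le K 0 fs"
| suc: "\<lbrakk> pure_dim C le K (Suc d); distinct fs; set fs = cells_of C le K (Suc d);
          \<forall>j<length fs. \<exists>e gs. shelling C le (bdry C le (fs ! j)) e gs;
          \<forall>j. 0 < j \<and> j < length fs \<longrightarrow>
              bdry C le (fs ! j) \<inter> (\<Union>i<j. bdry C le (fs ! i)) \<noteq> {} \<and>
              pure_dim C le (bdry C le (fs ! j) \<inter> (\<Union>i<j. bdry C le (fs ! i))) d \<and>
              (\<exists>gs. shelling C le (bdry C le (fs ! j)) d gs \<and>
                 set (take (card (cells_of C le (bdry C le (fs ! j) \<inter> (\<Union>i<j. bdry C le (fs ! i))) d)) gs)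
                   = cells_of C le (bdry C le (fs ! j) \<inter> (\<Union>i<j. bdry C le (fs ! i))) d) \<rbrakk>
         \<Longrightarrow> shelling C le K (Suc d) fs"

definition shellable_cw :: "'a set \<Rightarrow> ('a \<Rightarrow> 'a \<Rightarrow> bool) \<Rightarrow> bool" where
  "shellable_cw C le \<longleftrightarrow> (\<exists>d fs. shelling C le C d fs)"

text \<open>A (representative of an) X-forest: vertex set V (natural numbers), edge set E
(two-element subsets of V), and labelling map phi (only its values on X matter).\<close>
type_synonym 'x forest_rep = "nat set \<times> nat set set \<times> ('x \<Rightarrow> nat)"

definition fverts :: "'x forest_rep \<Rightarrow> nat set" where "fverts F = fst F"
definition fedges :: "'x forest_rep \<Rightarrow> nat set set" where "fedges F = fst (snd F)"
definition flab :: "'x forest_rep \<Rightarrow> 'x \<Rightarrow> nat" where "flab F = snd (snd F)"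

definition adj :: "'x forest_rep \<Rightarrow> nat \<Rightarrow> nat \<Rightarrow> bool" where
  "adj F u v \<longleftrightarrow> u \<noteq> v \<and> {u, v} \<in> fedges F"

definition vdegree :: "'x forest_rep \<Rightarrow> nat \<Rightarrow> nat" where
  "vdegree F v = card {e \<in> fedges F. v \<in> e}"

definition has_cycle :: "'x forest_rep \<Rightarrow> bool" where
  "has_cycle F \<longleftrightarrow> (\<exists>vs. length vs \<ge> 3 \<and> distinct vs \<and> set vs \<subseteq> fverts F \<and>
       (\<forall>i. Suc i < length vs \<longrightarrow> adj F (vs ! i) (vs ! Suc i)) \<and> adj F (last vs) (hd vs))"

definition is_X_forest :: "'x set \<Rightarrow> 'x forest_rep \<Rightarrow> bool" where
  "is_X_forest X F \<longleftrightarrow>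
     finite (fverts F) \<and>
     (\<forall>e\<in>fedges F. e \<subseteq> fverts F \<and> card e = 2) \<and>
     \<not> has_cycle F \<and>
     flab F ` X \<subseteq> fverts F \<and>
     \<comment> \<open>every component (tree) contains a labelled vertex, so the components are A-trees
         for the blocks A of a set partition of X\<close>
     (\<forall>v\<in>fverts F. \<exists>x\<in>X. (adj F)\<^sup>*\<^sup>* v (flab F x)) \<and>
     \<comment> \<open>unlabelled vertices have degree at least 3\<close>
     (\<forall>v\<in>fverts F. v \<notin> flab F ` X \<longrightarrow> vdegree F v \<ge> 3)"

definition forest_iso :: "'x set \<Rightarrow> 'x forest_rep \<Rightarrow> 'x forest_rep \<Rightarrow> bool" where
  "forest_iso X F G \<longleftrightarrow> (\<exists>h. bij_betw h (fverts F) (fverts G) \<and>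
      fedges G = (\<lambda>e. h ` e) ` fedges F \<and> (\<forall>x\<in>X. flab G x = h (flab F x)))"

definition contract_edge :: "'x forest_rep \<Rightarrow> nat \<Rightarrow> nat \<Rightarrow> 'x forest_rep" where
  "contract_edge F u v =
     (let r = (\<lambda>w. if w = v then u else w)
      in (fverts F - {v}, (\<lambda>e. r ` e) ` (fedges F - {{u, v}}), r \<circ> flab F))"

definition delete_edge :: "'x forest_rep \<Rightarrow> nat \<Rightarrow> nat \<Rightarrow> 'x forest_rep" where
  "delete_edge F u v = (fverts F, fedges F - {{u, v}}, flab F)"

definition safe_vertex :: "'x set \<Rightarrow> 'x forest_rep \<Rightarrow> nat \<Rightarrow> bool" where
  "safe_vertex X F w \<longleftrightarrow> w \<in> flab F ` X \<or> vdegree F w > 3"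

definition tuffley_step :: "'x set \<Rightarrow> 'x forest_rep \<Rightarrow> 'x forest_rep \<Rightarrow> bool" where
  "tuffley_step X F G \<longleftrightarrow> (\<exists>u v. adj F u v \<and>
      (G = contract_edge F u v \<or>
       (safe_vertex X F u \<and> safe_vertex X F v \<and> G = delete_edge F u v)))"

definition tuffley_poset :: "'x set \<Rightarrow> 'x forest_rep set set" where
  "tuffley_poset X = {{G. forest_iso X F G} | F. is_X_forest X F}"

definition tuffley_le :: "'x set \<Rightarrow> 'x forest_rep set \<Rightarrow> 'x forest_rep set \<Rightarrow> bool" where
  "tuffley_le X c' c \<longleftrightarrow> (\<exists>F\<in>c. \<exists>G\<in>c'. (tuffley_step X)\<^sup>*\<^sup>* F G)"

end

theory Submission
  imports Defs
begin

text \<open>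
Say that a forest separates two label sets if they lie in disjoint connected vertex sets. Separation
is inherited upwards in the Tuffley poset, and in a connected forest separating P from Q every
further label can be added to one of the two sides.

Suppose there were a shelling. Fix five labels Y and say that a facet covers a pair u in Y if it
separates u from Y - u. Every pair is covered by some facet. Let u = {a,b} be a pair that is covered
for the first time as late as possible, by the facet f_j. Splits of a tree are compatible, so f_j
misses some pair {p,q} in Y - u, and {p,q} is covered by an earlier facet f_i. The 0-cell whose only
nontrivial blocks are {a,b} and {p,q} lies in both f_i and f_j. By purity of the intersection of f_j
with its predecessors there is a ridge G of f_j above this 0-cell that also lies in some f_k with
k < j. A ridge is connected, so G separates {a,b} from {p,q} together with the fifth label r, or
{a,b,r} from {p,q}. In the first case f_k covers {a,b} too early, in the second f_j covers {p,q}.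
\<close>

section \<open>Forests and contractions\<close>

lemma forest_sel [simp]:
  "fverts (V, E, p) = V" "fedges (V, E, p) = E" "flab (V, E, p) = p"
  by (simp_all add: fverts_def fedges_def flab_def)

definition wf_rep :: "'x set \<Rightarrow> 'x forest_rep \<Rightarrow> bool" where
  "wf_rep X F \<longleftrightarrow> finite (fverts F) \<and> (\<forall>e\<in>fedges F. e \<subseteq> fverts F \<and> card e = 2) \<and>
     flab F ` X \<subseteq> fverts F"

definition bridged :: "'x forest_rep \<Rightarrow> bool" where
  "bridged F \<longleftrightarrow> (\<forall>u v. adj F u v \<longrightarrow> \<not> (\<lambda>x y. adj F x y \<and> {x, y} \<noteq> {u, v})\<^sup>*\<^sup>* u v)"

lemma adj_sym: "adj F u v \<Longrightarrow> adj F v u"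
  by (auto simp: adj_def insert_commute)

lemma rtranclp_sym:
  assumes "R\<^sup>*\<^sup>* x y" and "\<And>x y. R x y \<Longrightarrow> R y x"
  shows "R\<^sup>*\<^sup>* y x"
  using assms(1) by induction (auto intro: converse_rtranclp_into_rtranclp assms(2))

lemma rtranclp_via:
  assumes "R\<^sup>*\<^sup>* a b" "R b c" "R\<^sup>*\<^sup>* c d"
  shows "R\<^sup>*\<^sup>* a d"
  using assms by (meson rtranclp.rtrancl_into_rtrancl rtranclp_trans)

lemma wf_rep_adj: "wf_rep X F \<Longrightarrow> adj F u v \<Longrightarrow> u \<in> fverts F \<and> v \<in> fverts F"
  by (auto simp: wf_rep_def adj_def)

lemma wf_rep_finite_edges: "wf_rep X F \<Longrightarrow> finite (fedges F)"
  by (rule finite_subset[of _ "Pow (fverts F)"]) (auto simp: wf_rep_def)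

lemma wf_rep_edgeE:
  assumes "wf_rep X F" "e \<in> fedges F"
  obtains p q where "e = {p, q}" "p \<noteq> q" "adj F p q"
proof -
  have "card e = 2" using assms by (auto simp: wf_rep_def)
  then obtain p q where "e = {p, q}" "p \<noteq> q" by (auto simp: card_2_iff)
  then show ?thesis using assms that by (auto simp: adj_def)
qed

lemma rtranclp_distinct_path:
  assumes "R\<^sup>*\<^sup>* u v"
  shows "\<exists>xs. xs \<noteq> [] \<and> hd xs = u \<and> last xs = v \<and> distinct xs \<and> successively R xs"
  using assms
proof induction
  case base
  show ?case by (rule exI[of _ "[u]"]) simp
next
  case (step y z)
  then obtain xs where xs: "xs \<noteq> []" "hd xs = u" "last xs = y" "distinct xs" "successively R xs"
    by blast
  show ?case
  proof (cases "z \<in> set xs")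
    case True
    then obtain ps qs where "xs = ps @ z # qs" by (meson split_list)
    then show ?thesis using xs
      by (intro exI[of _ "ps @ [z]"])
         (cases ps; auto simp: successively_append_iff successively_Cons hd_append)
  next
    case False
    then show ?thesis using xs step
      by (intro exI[of _ "xs @ [z]"]) (auto simp: successively_append_iff)
  qed
qed

lemma acyclic_imp_bridged:
  assumes wf: "wf_rep X F" and ac: "\<not> has_cycle F"
  shows "bridged F"
  unfolding bridged_def
proof (intro allI impI notI)
  fix u v
  let ?R = "\<lambda>x y. adj F x y \<and> {x, y} \<noteq> {u, v}"
  assume uv: "adj F u v" and "?R\<^sup>*\<^sup>* u v"
  then obtain xs where xs: "xs \<noteq> []" "hd xs = u" "last xs = v" "distinct xs" "successively ?R xs"
    using rtranclp_distinct_path[of ?R u v] by blast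
  have succ: "?R (xs ! i) (xs ! Suc i)" if "Suc i < length xs" for i
    using xs(5) that by (simp add: successively_conv_nth)
  have "u \<noteq> v" using uv by (simp add: adj_def)
  have "length xs \<noteq> 1" using xs \<open>u \<noteq> v\<close> by (auto simp: length_Suc_conv)
  moreover have "length xs \<noteq> 2"
    using xs(2,3,5) by (auto simp: numeral_2_eq_2 length_Suc_conv)
  moreover have "length xs \<noteq> 0" using xs by simp
  ultimately have len: "length xs \<ge> 3" by linarith
  have "set xs \<subseteq> fverts F"
  proof
    fix x assume "x \<in> set xs"
    then obtain i where i: "i < length xs" "x = xs ! i" by (auto simp: in_set_conv_nth)
    show "x \<in> fverts F"
    proof (cases i)
      case 0
      then show ?thesis using succ[of 0] i len wf_rep_adj[OF wf, of "xs ! 0" "xs ! 1"] by simp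
    next
      case (Suc k)
      then show ?thesis using succ[of k] i wf_rep_adj[OF wf, of "xs ! k" "xs ! Suc k"] by simp
    qed
  qed
  then have "has_cycle F"
    unfolding has_cycle_def using len xs succ adj_sym[OF uv] by (intro exI[of _ xs]) auto
  with ac show False by simp
qed

lemma bridged_imp_acyclic:
  assumes "bridged F" shows "\<not> has_cycle F"
proof
  assume "has_cycle F"
  then obtain vs where len: "length vs \<ge> 3" and d: "distinct vs"
    and succ: "\<And>i. Suc i < length vs \<Longrightarrow> adj F (vs ! i) (vs ! Suc i)"
    and cl: "adj F (last vs) (hd vs)"
    unfolding has_cycle_def by blast
  let ?n = "length vs - 1"
  have hd: "hd vs = vs ! 0" and la: "last vs = vs ! ?n"
    using len by (simp_all add: hd_conv_nth last_conv_nth flip: length_greater_0_conv)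
  let ?R = "\<lambda>x y. adj F x y \<and> {x, y} \<noteq> {hd vs, last vs}"
  have ne: "{vs ! i, vs ! Suc i} \<noteq> {hd vs, last vs}" if "Suc i < length vs" for i
  proof
    assume "{vs ! i, vs ! Suc i} = {hd vs, last vs}"
    then have "(vs ! i = vs ! 0 \<and> vs ! Suc i = vs ! ?n) \<or> (vs ! i = vs ! ?n \<and> vs ! Suc i = vs ! 0)"
      unfolding hd la by (auto simp: doubleton_eq_iff)
    moreover have "0 < length vs" "?n < length vs" "i < length vs" using len that by auto
    ultimately have "(i = 0 \<and> Suc i = ?n) \<or> (i = ?n \<and> Suc i = 0)"
      using d that by (simp add: nth_eq_iff_index_eq del: One_nat_def)
    then show False using len by auto
  qed
  have "?R\<^sup>*\<^sup>* (vs ! 0) (vs ! i)" if "i < length vs" for i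
    using that
  proof (induction i)
    case (Suc i)
    then have "?R (vs ! i) (vs ! Suc i)" using succ ne by blast
    moreover have "?R\<^sup>*\<^sup>* (vs ! 0) (vs ! i)" using Suc by simp
    ultimately show ?case by (rule rtranclp.rtrancl_into_rtrancl[where r = ?R, rotated])
  qed simp
  then have "?R\<^sup>*\<^sup>* (hd vs) (last vs)" using len hd la by simp
  moreover have "adj F (hd vs) (last vs)" using cl by (rule adj_sym)
  ultimately show False using assms unfolding bridged_def by blast
qed

lemma is_X_forest_altdef:
  "is_X_forest X F \<longleftrightarrow> wf_rep X F \<and> bridged F \<and>
     (\<forall>v\<in>fverts F. \<exists>x\<in>X. (adj F)\<^sup>*\<^sup>* v (flab F x)) \<and>
     (\<forall>v\<in>fverts F. v \<notin> flab F ` X \<longrightarrow> vdegree F v \<ge> 3)"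
  using acyclic_imp_bridged[of X F] bridged_imp_acyclic[of F]
  by (auto simp: is_X_forest_def wf_rep_def)

definition merge :: "nat \<Rightarrow> nat \<Rightarrow> nat \<Rightarrow> nat" where
  "merge u v w = (if w = v then u else w)"

lemma merge_eq_iff: "merge u v a = merge u v b \<longleftrightarrow> a = b \<or> {a, b} = {u, v}"
  by (auto simp: merge_def doubleton_eq_iff)

lemma contract_sel [simp]:
  "fverts (contract_edge F u v) = fverts F - {v}"
  "fedges (contract_edge F u v) = (\<lambda>e. merge u v ` e) ` (fedges F - {{u, v}})"
  "flab (contract_edge F u v) = merge u v \<circ> flab F"
  by (auto simp: contract_edge_def Let_def merge_def[abs_def])

lemma delete_sel [simp]:
  "fverts (delete_edge F u v) = fverts F"
  "fedges (delete_edge F u v) = fedges F - {{u, v}}"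
  "flab (delete_edge F u v) = flab F"
  by (auto simp: delete_edge_def)

lemma adj_contractD:
  assumes "wf_rep X F" "adj (contract_edge F u v) x y"
  shows "\<exists>x0 y0. adj F x0 y0 \<and> {x0, y0} \<noteq> {u, v} \<and> merge u v x0 = x \<and> merge u v y0 = y"
proof -
  obtain e where e: "e \<in> fedges F" "e \<noteq> {u, v}" "merge u v ` e = {x, y}"
    using assms(2) by (auto simp: adj_def)
  obtain p q where pq: "e = {p, q}" "p \<noteq> q" "adj F p q" using wf_rep_edgeE[OF assms(1) e(1)] .
  then have "(merge u v p = x \<and> merge u v q = y) \<or> (merge u v p = y \<and> merge u v q = x)"
    using e(3) by (auto simp: doubleton_eq_iff)
  then show ?thesis using pq e(2) adj_sym[OF pq(3)] by (metis insert_commute)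
qed

lemma adj_contractI:
  assumes "adj F x y" "{x, y} \<noteq> {u, v}"
  shows "adj (contract_edge F u v) (merge u v x) (merge u v y)"
proof -
  have "merge u v x \<noteq> merge u v y" using assms by (auto simp: merge_eq_iff adj_def)
  moreover have "merge u v ` {x, y} \<in> fedges (contract_edge F u v)"
    using assms by (auto simp: adj_def simp del: image_insert)
  ultimately show ?thesis by (simp add: adj_def del: contract_sel)
qed

lemma adj_delete: "adj (delete_edge F u v) x y \<longleftrightarrow> adj F x y \<and> {x, y} \<noteq> {u, v}"
  by (auto simp: adj_def)

lemma wf_rep_contract:
  assumes wf: "wf_rep X F" and uv: "adj F u v"
  shows "wf_rep X (contract_edge F u v)"
proof -
  have uv': "u \<in> fverts F" "v \<in> fverts F" "u \<noteq> v"
    using wf_rep_adj[OF wf uv] uv by (auto simp: adj_def)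
  have "merge u v ` e \<subseteq> fverts F - {v} \<and> card (merge u v ` e) = 2"
    if e: "e \<in> fedges F" "e \<noteq> {u, v}" for e
  proof -
    obtain p q where pq: "e = {p, q}" "p \<noteq> q" "adj F p q" using wf_rep_edgeE[OF wf e(1)] .
    have "merge u v p \<noteq> merge u v q" using pq e(2) by (simp add: merge_eq_iff)
    moreover have "merge u v w \<in> fverts F - {v}" if "w \<in> fverts F" for w
      using that uv' by (simp add: merge_def)
    ultimately show ?thesis using pq(1) wf_rep_adj[OF wf pq(3)] by simp
  qed
  moreover have "merge u v (flab F x) \<in> fverts F - {v}" if "x \<in> X" for x
    using wf uv' that by (auto simp: wf_rep_def merge_def)
  moreover have "finite (fverts F)" using wf by (simp add: wf_rep_def)
  ultimately show ?thesis unfolding wf_rep_def by auto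
qed

lemma wf_rep_delete: "wf_rep X F \<Longrightarrow> wf_rep X (delete_edge F u v)"
  by (auto simp: wf_rep_def)

lemma wf_rep_step: "wf_rep X F \<Longrightarrow> tuffley_step X F G \<Longrightarrow> wf_rep X G"
  by (auto simp: tuffley_step_def wf_rep_contract wf_rep_delete)

lemma wf_rep_steps: "(tuffley_step X)\<^sup>*\<^sup>* F G \<Longrightarrow> wf_rep X F \<Longrightarrow> wf_rep X G"
  by (induction rule: rtranclp_induct) (auto intro: wf_rep_step)

lemma card_edges_step:
  assumes wf: "wf_rep X F" and "tuffley_step X F G"
  shows "card (fedges G) < card (fedges F)"
proof -
  obtain u v where uv: "adj F u v" and G: "G = contract_edge F u v \<or> G = delete_edge F u v"
    using assms(2) by (auto simp: tuffley_step_def)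
  have fin: "finite (fedges F)" using wf by (rule wf_rep_finite_edges)
  have lt: "card (fedges F - {{u, v}}) < card (fedges F)"
    using uv by (intro card_Diff1_less fin) (auto simp: adj_def)
  have "card (fedges G) \<le> card (fedges F - {{u, v}})"
    using G card_image_le[of "fedges F - {{u, v}}" "\<lambda>e. merge u v ` e"] fin by auto
  with lt show ?thesis by simp
qed

lemma card_edges_steps:
  assumes "(tuffley_step X)\<^sup>*\<^sup>* F G" "wf_rep X F"
  shows "G = F \<or> card (fedges G) < card (fedges F)"
  using assms
proof (induction rule: rtranclp_induct)
  case (step G H)
  then have "wf_rep X G" using wf_rep_steps by blast
  then show ?case using card_edges_step[OF _ step(2)] step by fastforce
qed simp

lemma contract_lift:
  assumes "wf_rep X F" and "(\<lambda>a b. adj (contract_edge F u v) a b \<and> {a, b} \<noteq> {merge u v x0, merge u v y0})\<^sup>*\<^sup>* a b"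
    and "merge u v a0 = a" "merge u v b0 = b" and "adj F u v" "{x0, y0} \<noteq> {u, v}"
  shows "(\<lambda>p q. adj F p q \<and> {p, q} \<noteq> {x0, y0})\<^sup>*\<^sup>* a0 b0"
proof -
  let ?R = "\<lambda>p q. adj F p q \<and> {p, q} \<noteq> {x0, y0}"
  have same: "?R\<^sup>*\<^sup>* p q" if "merge u v p = merge u v q" for p q
  proof (cases "p = q")
    case False
    then have pq: "{p, q} = {u, v}" using that by (auto simp: merge_eq_iff)
    then have "adj F p q" using assms(5) adj_sym[OF assms(5)] by (auto simp: doubleton_eq_iff)
    then have "?R p q" using pq assms(6) by auto
    then show ?thesis by (rule r_into_rtranclp)
  qed simp
  show ?thesis using assms(2) assms(4)
  proof (induction arbitrary: b0 rule: rtranclp_induct)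
    case base
    then show ?case using assms(3) same[of a0 b0] by simp
  next
    case (step b c)
    obtain b1 c1 where bc: "adj F b1 c1" "merge u v b1 = b" "merge u v c1 = c"
      using adj_contractD[OF assms(1)] step(2) by blast
    have "{b1, c1} \<noteq> {x0, y0}"
    proof
      assume "{b1, c1} = {x0, y0}"
      then have "merge u v ` {b1, c1} = merge u v ` {x0, y0}" by simp
      then show False using step(2) bc by simp
    qed
    then have "?R b1 c1" using bc by simp
    moreover have "?R\<^sup>*\<^sup>* a0 b1" using step.IH bc by simp
    moreover have "?R\<^sup>*\<^sup>* c1 b0" using same bc step.prems by simp
    ultimately show ?case using rtranclp_via[of ?R a0 b1 c1 b0] by blast
  qed
qed

lemma bridged_contract:
  assumes wf: "wf_rep X F" and br: "bridged F" and uv: "adj F u v"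
  shows "bridged (contract_edge F u v)"
  unfolding bridged_def
proof (intro allI impI notI)
  fix x y
  assume xy: "adj (contract_edge F u v) x y"
    and c: "(\<lambda>a b. adj (contract_edge F u v) a b \<and> {a, b} \<noteq> {x, y})\<^sup>*\<^sup>* x y"
  obtain x0 y0 where l: "adj F x0 y0" "{x0, y0} \<noteq> {u, v}" "merge u v x0 = x" "merge u v y0 = y"
    using adj_contractD[OF wf xy] by blast
  have "(\<lambda>p q. adj F p q \<and> {p, q} \<noteq> {x0, y0})\<^sup>*\<^sup>* x0 y0"
    by (rule contract_lift[OF wf _ l(3,4) uv l(2)]) (use c l in simp)
  then show False using br l(1) unfolding bridged_def by blast
qed

lemma inj_on_contract_edges:
  assumes wf: "wf_rep X F" and br: "bridged F" and uv: "adj F u v"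
  shows "inj_on (\<lambda>e. merge u v ` e) (fedges F - {{u, v}})"
proof (rule inj_onI, rule ccontr)
  fix e1 e2
  assume "e1 \<in> fedges F - {{u, v}}" "e2 \<in> fedges F - {{u, v}}"
    and e: "merge u v ` e1 = merge u v ` e2" "e1 \<noteq> e2"
  then have e1: "e1 \<in> fedges F" "e1 \<noteq> {u, v}" and e2: "e2 \<in> fedges F" "e2 \<noteq> {u, v}" by auto
  obtain p q where pq: "e1 = {p, q}" "p \<noteq> q" "adj F p q"
    using wf_rep_edgeE[OF wf e1(1)] .
  obtain p' q' where pq': "e2 = {p', q'}" "adj F p' q'" "merge u v p = merge u v p'" "merge u v q = merge u v q'"
  proof -
    obtain s t where st: "e2 = {s, t}" "s \<noteq> t" "adj F s t" using wf_rep_edgeE[OF wf e2(1)] .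
    have "{merge u v p, merge u v q} = {merge u v s, merge u v t}" using e pq st by simp
    then have "(merge u v p = merge u v s \<and> merge u v q = merge u v t) \<or>
      (merge u v p = merge u v t \<and> merge u v q = merge u v s)" by (auto simp: doubleton_eq_iff)
    then show ?thesis using that st adj_sym[OF st(3)] by (metis insert_commute)
  qed
  let ?R = "\<lambda>x y. adj F x y \<and> {x, y} \<noteq> {p, q}"
  have base: "?R\<^sup>*\<^sup>* a b" if "merge u v a = merge u v b" for a b
  proof (cases "a = b")
    case False
    then have ab: "{a, b} = {u, v}" using that by (auto simp: merge_eq_iff)
    then have "adj F a b" using uv adj_sym[OF uv] by (auto simp: doubleton_eq_iff)
    then have "?R a b" using ab e1 pq by auto
    then show ?thesis by (rule r_into_rtranclp)
  qed simp
  have "?R\<^sup>*\<^sup>* p p'" using base pq' by blast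
  moreover have "?R p' q'" using pq' pq e by auto
  moreover have "?R\<^sup>*\<^sup>* q' q" using base[of q' q] pq' by simp
  ultimately have "?R\<^sup>*\<^sup>* p q" using rtranclp_via[of ?R p p' q' q] by blast
  then show False using br pq(3) unfolding bridged_def by blast
qed

lemma card_edges_contract:
  assumes wf: "wf_rep X F" and br: "bridged F" and uv: "adj F u v"
  shows "Suc (card (fedges (contract_edge F u v))) = card (fedges F)"
proof -
  have "card (fedges (contract_edge F u v)) = card (fedges F - {{u, v}})"
    using card_image[OF inj_on_contract_edges[OF assms]] by simp
  moreover have "{u, v} \<in> fedges F" using uv by (simp add: adj_def)
  ultimately show ?thesis using wf_rep_finite_edges[OF wf]
    by (metis card_Suc_Diff1)
qed

lemma vdegree_contract:
  assumes wf: "wf_rep X F" and br: "bridged F" and uv: "adj F u v"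
  shows "vdegree (contract_edge F u v) w =
     card {e \<in> fedges F - {{u, v}}. w \<in> merge u v ` e}"
proof -
  have "{e \<in> fedges (contract_edge F u v). w \<in> e} =
     (\<lambda>e. merge u v ` e) ` {e \<in> fedges F - {{u, v}}. w \<in> merge u v ` e}"
    by auto
  moreover have "inj_on (\<lambda>e. merge u v ` e) {e \<in> fedges F - {{u, v}}. w \<in> merge u v ` e}"
    by (rule inj_on_subset[OF inj_on_contract_edges[OF assms]]) auto
  ultimately show ?thesis unfolding vdegree_def by (simp add: card_image)
qed

lemma is_X_forest_contract:
  assumes F: "is_X_forest X F" and uv: "adj F u v"
  shows "is_X_forest X (contract_edge F u v)"
proof -
  let ?G = "contract_edge F u v"
  have wf: "wf_rep X F" and br: "bridged F" using F by (auto simp: is_X_forest_altdef)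
  have fin: "finite (fedges F)" using wf by (rule wf_rep_finite_edges)
  have uv': "u \<noteq> v" "u \<in> fverts F" "v \<in> fverts F"
    using uv wf_rep_adj[OF wf uv] by (auto simp: adj_def)
  have lift: "(adj ?G)\<^sup>*\<^sup>* (merge u v a) (merge u v b)" if "(adj F)\<^sup>*\<^sup>* a b" for a b
    using that
  proof induction
    case (step y z)
    show ?case
    proof (cases "{y, z} = {u, v}")
      case True
      then have "merge u v y = merge u v z" by (simp add: merge_eq_iff)
      then show ?thesis using step by simp
    next
      case False
      then show ?thesis using step adj_contractI[of F y z u v] by (meson rtranclp.rtrancl_into_rtrancl)
    qed
  qed simp
  have "\<exists>x\<in>X. (adj ?G)\<^sup>*\<^sup>* w (flab ?G x)" if w: "w \<in> fverts ?G" for w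
  proof -
    obtain x where x: "x \<in> X" "(adj F)\<^sup>*\<^sup>* w (flab F x)"
      using F w by (auto simp: is_X_forest_altdef)
    have "merge u v w = w" using w by (simp add: merge_def)
    then show ?thesis using lift[OF x(2)] x(1) by auto
  qed
  moreover have "vdegree ?G w \<ge> 3" if w: "w \<in> fverts ?G" "w \<notin> flab ?G ` X" for w
  proof (cases "w = u")
    case False
    have "w \<notin> flab F ` X" using w by (force simp: merge_def)
    then have "vdegree F w \<ge> 3" using F w by (auto simp: is_X_forest_altdef)
    moreover have "{e \<in> fedges F - {{u, v}}. w \<in> merge u v ` e} = {e \<in> fedges F. w \<in> e}"
      using False w by (auto simp: merge_def image_iff split: if_splits)
    ultimately show ?thesis using vdegree_contract[OF wf br uv, of w] by (simp add: vdegree_def)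
  next
    case True
    have nl: "u \<notin> flab F ` X" "v \<notin> flab F ` X" using w True by (force simp: merge_def)+
    let ?A = "{e \<in> fedges F. u \<in> e} - {{u, v}}" and ?B = "{e \<in> fedges F. v \<in> e} - {{u, v}}"
    have d: "vdegree F u \<ge> 3" "vdegree F v \<ge> 3"
      using F nl uv' by (auto simp: is_X_forest_altdef)
    have "{u, v} \<in> fedges F" using uv by (simp add: adj_def)
    then have "card ?A \<ge> 2" "card ?B \<ge> 2"
      using d fin by (auto simp: vdegree_def)
    moreover have "?A \<inter> ?B = {}"
    proof (rule ccontr)
      assume "?A \<inter> ?B \<noteq> {}"
      then obtain e where e: "e \<in> fedges F" "u \<in> e" "v \<in> e" "e \<noteq> {u, v}" by auto
      obtain p q where "e = {p, q}" "p \<noteq> q" "adj F p q" using wf_rep_edgeE[OF wf e(1)] .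
      then show False using e uv' by auto
    qed
    ultimately have "card (?A \<union> ?B) \<ge> 4" using fin by (subst card_Un_disjoint) auto
    moreover have "{e \<in> fedges F - {{u, v}}. w \<in> merge u v ` e} = ?A \<union> ?B"
      using True uv' by (auto simp: merge_def image_iff split: if_splits)
    ultimately show ?thesis using vdegree_contract[OF wf br uv, of w] by simp
  qed
  ultimately show ?thesis
    using wf_rep_contract[OF wf uv] bridged_contract[OF wf br uv]
    unfolding is_X_forest_altdef by blast
qed

lemma card_edges_le_verts:
  assumes "wf_rep X F" "bridged F"
  shows "card (fedges F) \<le> card (fverts F)"
  using assms
proof (induction "card (fedges F)" arbitrary: F)
  case (Suc n)
  have "fedges F \<noteq> {}" using Suc.hyps(2) by (metis Zero_not_Suc card.empty)
  then obtain e where e: "e \<in> fedges F" by blast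
  obtain u v where uv: "adj F u v" using wf_rep_edgeE[OF Suc.prems(1) e] .
  let ?G = "contract_edge F u v"
  have "Suc (card (fedges ?G)) = card (fedges F)" using card_edges_contract[OF Suc.prems uv] .
  moreover have "card (fedges ?G) \<le> card (fverts ?G)"
    using Suc.hyps(1)[of ?G] calculation Suc.hyps(2) wf_rep_contract[OF Suc.prems(1) uv]
      bridged_contract[OF Suc.prems uv] by linarith
  moreover have "Suc (card (fverts ?G)) = card (fverts F)"
    using wf_rep_adj[OF Suc.prems(1) uv] Suc.prems(1) by (simp add: wf_rep_def card_Suc_Diff1 del: card_Diff_insert)
  ultimately show ?case by linarith
qed simp

lemma card_edges_bound:
  assumes F: "is_X_forest X F" and "finite X"
  shows "card (fedges F) \<le> 3 * card X"
proof -
  have wf: "wf_rep X F" and br: "bridged F" using F by (auto simp: is_X_forest_altdef)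
  have fE: "finite (fedges F)" and fV: "finite (fverts F)"
    using wf wf_rep_finite_edges[OF wf] by (simp_all add: wf_rep_def)
  let ?U = "fverts F - flab F ` X"
  have "(\<Sum>v\<in>fverts F. vdegree F v) = 2 * card (fedges F)"
    unfolding vdegree_def
  proof (rule sum_multicount[OF fV fE])
    have "card {v \<in> fverts F. v \<in> e} = 2" if "e \<in> fedges F" for e
    proof -
      have "{v \<in> fverts F. v \<in> e} = e" using wf that by (auto simp: wf_rep_def)
      then show ?thesis using wf that by (simp add: wf_rep_def)
    qed
    then show "\<forall>e\<in>fedges F. card {v \<in> fverts F. v \<in> e} = 2" by blast
  qed
  moreover have "(\<Sum>v\<in>?U. 3) \<le> (\<Sum>v\<in>?U. vdegree F v)"
    by (rule sum_mono) (use F in \<open>auto simp: is_X_forest_altdef\<close>)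
  moreover have "(\<Sum>v\<in>?U. vdegree F v) \<le> (\<Sum>v\<in>fverts F. vdegree F v)"
    by (rule sum_mono2) (use fV in auto)
  moreover have "card ?U \<ge> card (fverts F) - card (flab F ` X)"
    using \<open>finite X\<close> by (intro diff_card_le_card_Diff) auto
  moreover have "card (flab F ` X) \<le> card X" using \<open>finite X\<close> by (rule card_image_le)
  ultimately show ?thesis using card_edges_le_verts[OF wf br] by simp
qed

section \<open>Separation by disjoint connected sets\<close>

definition joined :: "'x forest_rep \<Rightarrow> nat set \<Rightarrow> nat \<Rightarrow> nat \<Rightarrow> bool" where
  "joined F A = (\<lambda>x y. adj F x y \<and> x \<in> A \<and> y \<in> A)\<^sup>*\<^sup>*"

definition conn_set :: "'x forest_rep \<Rightarrow> nat set \<Rightarrow> bool" where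
  "conn_set F A \<longleftrightarrow> (\<forall>x\<in>A. \<forall>y\<in>A. joined F A x y)"

definition sep :: "'x forest_rep \<Rightarrow> 'x set \<Rightarrow> 'x set \<Rightarrow> bool" where
  "sep F P Q \<longleftrightarrow> (\<exists>A B. A \<subseteq> fverts F \<and> B \<subseteq> fverts F \<and> A \<inter> B = {} \<and>
     conn_set F A \<and> conn_set F B \<and> flab F ` P \<subseteq> A \<and> flab F ` Q \<subseteq> B)"

lemma sepI:
  assumes "A \<subseteq> fverts F" "B \<subseteq> fverts F" "A \<inter> B = {}" "conn_set F A" "conn_set F B"
    "flab F ` P \<subseteq> A" "flab F ` Q \<subseteq> B"
  shows "sep F P Q"
  unfolding sep_def using assms by metis

lemma sepE:
  assumes "sep F P Q"
  obtains A B where "A \<subseteq> fverts F" "B \<subseteq> fverts F" "A \<inter> B = {}" "conn_set F A" "conn_set F B"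
    "flab F ` P \<subseteq> A" "flab F ` Q \<subseteq> B"
  using assms unfolding sep_def by metis

lemma joined_refl [simp]: "joined F A x x"
  by (simp add: joined_def)

lemma joined_trans: "joined F A x y \<Longrightarrow> joined F A y z \<Longrightarrow> joined F A x z"
  unfolding joined_def by (rule rtranclp_trans)

lemma joined_step: "adj F x y \<Longrightarrow> x \<in> A \<Longrightarrow> y \<in> A \<Longrightarrow> joined F A x y"
  unfolding joined_def by (rule r_into_rtranclp) simp

lemma joined_sym: "joined F A x y \<Longrightarrow> joined F A y x"
  unfolding joined_def by (erule rtranclp_sym) (auto intro: adj_sym)

lemma joined_induct [consumes 1, case_names base step]:
  assumes "joined F A x y" "P x"
    and "\<And>y z. joined F A x y \<Longrightarrow> P y \<Longrightarrow> adj F y z \<Longrightarrow> y \<in> A \<Longrightarrow> z \<in> A \<Longrightarrow> P z"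
  shows "P y"
  using assms(1) unfolding joined_def
  by (induction rule: rtranclp_induct) (use assms(2,3) in \<open>auto simp: joined_def\<close>)

lemma joined_map:
  assumes "joined F A x y"
    and "\<And>x y. adj F x y \<Longrightarrow> x \<in> A \<Longrightarrow> y \<in> A \<Longrightarrow> joined G B (h x) (h y)"
  shows "joined G B (h x) (h y)"
  using assms(1) by (induction rule: joined_induct) (auto intro: joined_trans assms(2))

lemma joined_mono:
  assumes "joined F A x y" "A \<subseteq> B" "\<And>x y. adj F x y \<Longrightarrow> x \<in> A \<Longrightarrow> y \<in> A \<Longrightarrow> adj G x y"
  shows "joined G B x y"
  by (rule joined_map[OF assms(1), where h = id, simplified]) (use assms in \<open>auto intro: joined_step\<close>)

lemma joined_verts:
  assumes "wf_rep X F" "(adj F)\<^sup>*\<^sup>* x y"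
  shows "joined F (fverts F) x y"
  using assms(2)
  by induction (auto intro: joined_trans joined_step dest: wf_rep_adj[OF assms(1)])

lemma conn_set_center:
  assumes "\<And>x. x \<in> A \<Longrightarrow> joined F A x c"
  shows "conn_set F A"
  unfolding conn_set_def using assms joined_trans joined_sym by blast

lemma forest_iso_refl: "forest_iso X F F"
  unfolding forest_iso_def by (rule exI[of _ id]) simp

lemma forest_iso_sym:
  assumes wf: "wf_rep X F" and "forest_iso X F G"
  shows "forest_iso X G F"
proof -
  obtain h where h: "bij_betw h (fverts F) (fverts G)" "fedges G = (\<lambda>e. h ` e) ` fedges F"
    "\<forall>x\<in>X. flab G x = h (flab F x)" using assms(2) unfolding forest_iso_def by blast
  let ?k = "inv_into (fverts F) h"
  have k: "?k (h w) = w" if "w \<in> fverts F" for w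
    using h(1) that by (simp add: bij_betw_def)
  have "?k ` h ` e = e" if "e \<in> fedges F" for e
  proof -
    have "e \<subseteq> fverts F" using wf that by (simp add: wf_rep_def)
    then have "(\<lambda>w. ?k (h w)) ` e = (\<lambda>w. w) ` e" by (intro image_cong) (auto intro: k)
    then show ?thesis by (simp add: image_image)
  qed
  then have "fedges F = (\<lambda>e. ?k ` e) ` fedges G" by (force simp: h(2) image_image)
  moreover have "\<forall>x\<in>X. flab F x = ?k (flab G x)" using h(3) k wf by (auto simp: wf_rep_def)
  ultimately show ?thesis unfolding forest_iso_def using bij_betw_inv_into[OF h(1)] by blast
qed

lemma forest_iso_trans:
  assumes "forest_iso X F G" "forest_iso X G H"
  shows "forest_iso X F H"
proof -
  obtain h where h: "bij_betw h (fverts F) (fverts G)" "fedges G = (\<lambda>e. h ` e) ` fedges F"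
    "\<forall>x\<in>X. flab G x = h (flab F x)" using assms(1) unfolding forest_iso_def by blast
  obtain k where k: "bij_betw k (fverts G) (fverts H)" "fedges H = (\<lambda>e. k ` e) ` fedges G"
    "\<forall>x\<in>X. flab H x = k (flab G x)" using assms(2) unfolding forest_iso_def by blast
  show ?thesis unfolding forest_iso_def
    by (rule exI[of _ "k \<circ> h"])
       (use h k in \<open>auto simp: bij_betw_trans image_image image_comp\<close>)
qed

lemma forest_iso_edges_inj:
  assumes wf: "wf_rep X F" and "bij_betw h (fverts F) V"
  shows "inj_on (\<lambda>e. h ` e) (fedges F)"
proof (rule inj_onI)
  fix e e' assume "e \<in> fedges F" "e' \<in> fedges F" and eq: "h ` e = h ` e'"
  then have "e \<subseteq> fverts F" "e' \<subseteq> fverts F" using wf by (auto simp: wf_rep_def)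
  then show "e = e'" using eq inj_on_image_eq_iff[of h "fverts F" e e'] assms(2) by (simp add: bij_betw_def)
qed

lemma forest_iso_card_edges:
  assumes wf: "wf_rep X F" and "forest_iso X F G"
  shows "card (fedges G) = card (fedges F)"
  using assms(2) forest_iso_edges_inj[OF wf] card_image unfolding forest_iso_def by metis

lemma forest_iso_wf:
  assumes wf: "wf_rep X F" and "forest_iso X F G"
  shows "wf_rep X G"
proof -
  obtain h where h: "bij_betw h (fverts F) (fverts G)" "fedges G = (\<lambda>e. h ` e) ` fedges F"
    "\<forall>x\<in>X. flab G x = h (flab F x)" using assms(2) unfolding forest_iso_def by blast
  have V: "fverts G = h ` fverts F" and inj: "inj_on h (fverts F)" using h(1) by (auto simp: bij_betw_def)
  have "card (h ` e) = 2" if "e \<in> fedges F" for e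
    using wf that inj by (metis card_image inj_on_subset wf_rep_def)
  then show ?thesis using wf h(2,3) unfolding wf_rep_def V by (auto simp: subset_iff)
qed

lemma sep_iso:
  assumes wf: "wf_rep X F" and "forest_iso X F G" and PQ: "P \<subseteq> X" "Q \<subseteq> X" and "sep F P Q"
  shows "sep G P Q"
proof -
  obtain h where h: "bij_betw h (fverts F) (fverts G)" "fedges G = (\<lambda>e. h ` e) ` fedges F"
    "\<forall>x\<in>X. flab G x = h (flab F x)" using assms(2) unfolding forest_iso_def by blast
  have V: "fverts G = h ` fverts F" and inj: "inj_on h (fverts F)" using h(1) by (auto simp: bij_betw_def)
  obtain A B where AB: "A \<subseteq> fverts F" "B \<subseteq> fverts F" "A \<inter> B = {}"
    "conn_set F A" "conn_set F B" "flab F ` P \<subseteq> A" "flab F ` Q \<subseteq> B"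
    using sepE[OF assms(5)] .
  have adj: "adj G (h x) (h y)" if "adj F x y" for x y
  proof -
    have "x \<noteq> y" "{x, y} \<in> fedges F" using that by (simp_all add: adj_def)
    moreover have "h x \<noteq> h y" using \<open>x \<noteq> y\<close> wf_rep_adj[OF wf that] inj_onD[OF inj] by blast
    moreover have "h ` {x, y} \<in> fedges G" using \<open>{x, y} \<in> fedges F\<close> unfolding h(2) by (rule imageI)
    ultimately show ?thesis by (simp add: adj_def)
  qed
  have conn: "conn_set G (h ` S)" if "conn_set F S" for S
    unfolding conn_set_def
  proof (intro ballI)
    fix a b assume "a \<in> h ` S" "b \<in> h ` S"
    then obtain x y where "x \<in> S" "y \<in> S" "a = h x" "b = h y" by blast
    moreover have "joined G (h ` S) (h x) (h y)" if "adj F x y" "x \<in> S" "y \<in> S" for x y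
      using that by (intro joined_step adj) auto
    ultimately show "joined G (h ` S) a b"
      using joined_map[of F S x y G "h ` S" h] that by (simp add: conn_set_def)
  qed
  have "h ` A \<inter> h ` B = {}" using AB inj by (metis image_empty inj_on_image_Int)
  moreover have "flab G ` P \<subseteq> h ` A" "flab G ` Q \<subseteq> h ` B" using AB PQ h(3) by (auto simp: subset_iff)
  moreover have "h ` A \<subseteq> fverts G" "h ` B \<subseteq> fverts G" using AB(1,2) V by auto
  ultimately show ?thesis using conn[OF AB(4)] conn[OF AB(5)] by (intro sepI[of "h ` A" _ "h ` B"])
qed

lemma sep_contract:
  assumes wf: "wf_rep X F" and uv: "adj F u v" and PQ: "P \<subseteq> X" "Q \<subseteq> X"
    and s: "sep (contract_edge F u v) P Q"
  shows "sep F P Q"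
proof -
  let ?G = "contract_edge F u v" and ?m = "merge u v"
  have uv': "u \<in> fverts F" "v \<in> fverts F" using wf_rep_adj[OF wf uv] by auto
  obtain A B where AB: "A \<subseteq> fverts ?G" "B \<subseteq> fverts ?G" "A \<inter> B = {}"
    "conn_set ?G A" "conn_set ?G B" "flab ?G ` P \<subseteq> A" "flab ?G ` Q \<subseteq> B"
    using sepE[OF s] .
  define pre where "pre S = {x \<in> fverts F. ?m x \<in> S}" for S
  have same: "joined F (pre S) x y" if "?m x = ?m y" "x \<in> pre S" "y \<in> pre S" for x y S
  proof (cases "x = y")
    case False
    then have "{x, y} = {u, v}" using that(1) by (auto simp: merge_eq_iff)
    then have "adj F x y" using uv adj_sym[OF uv] by (auto simp: doubleton_eq_iff)
    then show ?thesis using that joined_step by blast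
  qed simp
  have lift: "joined F (pre S) x y"
    if "joined ?G S a b" "x \<in> pre S" "y \<in> pre S" "?m x = a" "?m y = b" for S x y a b
    using that(1,3,5)
  proof (induction arbitrary: y rule: joined_induct)
    case base
    then show ?case using that same by blast
  next
    case (step b c)
    obtain b1 c1 where bc: "adj F b1 c1" "?m b1 = b" "?m c1 = c"
      using adj_contractD[OF wf step.hyps(2)] by blast
    then have "b1 \<in> pre S" "c1 \<in> pre S" using wf_rep_adj[OF wf bc(1)] step by (auto simp: pre_def)
    then show ?case using step bc same[of c1 y S] joined_step[OF bc(1)] joined_trans by metis
  qed
  have "conn_set F (pre S)" if "conn_set ?G S" for S
    unfolding conn_set_def
  proof (intro ballI)
    fix x y assume xy: "x \<in> pre S" "y \<in> pre S"
    then have "joined ?G S (?m x) (?m y)" using that by (simp add: conn_set_def pre_def)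
    then show "joined F (pre S) x y" using lift xy by blast
  qed
  moreover have "flab F x \<in> fverts F" if "x \<in> P \<union> Q" for x
    using wf PQ that by (auto simp: wf_rep_def image_subset_iff)
  ultimately show ?thesis using AB
    by (intro sepI[of "pre A" _ "pre B"]) (auto simp: pre_def subset_iff)
qed

lemma sep_delete:
  assumes "sep (delete_edge F u v) P Q"
  shows "sep F P Q"
proof -
  have "conn_set F S" if "conn_set (delete_edge F u v) S" for S
    using that unfolding conn_set_def by (blast intro: joined_mono dest: adj_delete[THEN iffD1])
  then show ?thesis using assms unfolding sep_def by auto
qed

lemma sep_step:
  "wf_rep X F \<Longrightarrow> tuffley_step X F G \<Longrightarrow> P \<subseteq> X \<Longrightarrow> Q \<subseteq> X \<Longrightarrow> sep G P Q \<Longrightarrow> sep F P Q"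
  by (auto simp: tuffley_step_def intro: sep_contract sep_delete)

lemma sep_steps:
  assumes "(tuffley_step X)\<^sup>*\<^sup>* F G" "wf_rep X F" "P \<subseteq> X" "Q \<subseteq> X" "sep G P Q"
  shows "sep F P Q"
  using assms
  by (induction rule: rtranclp_induct) (auto intro: sep_step wf_rep_steps)

definition retraction :: "'x forest_rep \<Rightarrow> nat set \<Rightarrow> (nat \<Rightarrow> nat) \<Rightarrow> bool" where
  "retraction F S r \<longleftrightarrow>
     (\<forall>v\<in>S. r v \<in> S \<and> r (r v) = r v \<and> joined F {w \<in> S. r w = r v} v (r v))"

lemma extend_retraction:
  assumes conn: "conn_set F V" and "finite V" and "S \<subseteq> V" "S \<noteq> {}" "retraction F S r"
  shows "\<exists>r'. retraction F V r' \<and> (\<forall>v\<in>S. r' v = r v) \<and> r' ` V = r ` S"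
  using assms(3-)
proof (induction "card (V - S)" arbitrary: S r)
  case 0
  then have "S = V" using \<open>finite V\<close> by auto
  then show ?case using 0 by blast
next
  case (Suc n)
  then obtain t where t: "t \<in> V" "t \<notin> S"
    by (metis Diff_eq_empty_iff card.empty nat.distinct(1) subsetI)
  obtain s where s: "s \<in> S" using Suc by blast
  have "joined F V s t" using conn s t Suc.prems(1) by (auto simp: conn_set_def)
  then have "t \<in> S \<or> (\<exists>p q. adj F p q \<and> p \<in> S \<and> q \<in> V - S)"
    by (induction rule: joined_induct) (use s in auto)
  then obtain p q where pq: "adj F p q" "p \<in> S" "q \<in> V" "q \<notin> S" using t by blast
  let ?S = "insert q S" and ?r = "r(q := r p)"
  have rp: "r p \<in> S" "r (r p) = r p" "joined F {w \<in> S. r w = r p} p (r p)"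
    using Suc.prems(3) pq by (auto simp: retraction_def)
  have mono: "joined F {w \<in> ?S. ?r w = c} x y" if "joined F {w \<in> S. r w = c} x y" for c x y
    using that by (rule joined_mono) (use pq in auto)
  have "retraction F ?S ?r"
    unfolding retraction_def
  proof
    fix v assume v: "v \<in> ?S"
    show "?r v \<in> ?S \<and> ?r (?r v) = ?r v \<and> joined F {w \<in> ?S. ?r w = ?r v} v (?r v)"
    proof (cases "v = q")
      case True
      have "joined F {w \<in> ?S. ?r w = r p} q p"
        by (rule joined_step) (use pq adj_sym[OF pq(1)] in auto)
      then have "joined F {w \<in> ?S. ?r w = r p} q (r p)" using mono[OF rp(3)] joined_trans by blast
      then show ?thesis using True rp pq by auto
    next
      case False
      then have vS: "v \<in> S" using v by blast
      then have rv: "r v \<in> S" "r (r v) = r v" "joined F {w \<in> S. r w = r v} v (r v)"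
        using Suc.prems(3) by (auto simp: retraction_def)
      then show ?thesis using False mono[OF rv(3)] pq by auto
    qed
  qed
  moreover have "n = card (V - ?S)"
    using Suc.hyps(2) pq \<open>finite V\<close> by (simp add: Diff_insert[of V q S])
  ultimately obtain r' where r': "retraction F V r'" "\<forall>v\<in>?S. r' v = ?r v" "r' ` V = ?r ` ?S"
    using Suc.hyps(1)[of ?S ?r] Suc.prems pq by auto
  have "?r ` ?S = r ` S" using pq by auto
  then show ?case using r' pq by (intro exI[of _ r']) auto
qed

lemma sep_cover:
  assumes conn: "conn_set F (fverts F)" and fin: "finite (fverts F)" and s: "sep F P Q"
    and ne: "P \<noteq> {}" "Q \<noteq> {}"
  obtains A B where "A \<union> B = fverts F" "A \<inter> B = {}" "conn_set F A" "conn_set F B"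
    "flab F ` P \<subseteq> A" "flab F ` Q \<subseteq> B"
proof -
  obtain A B where AB: "A \<subseteq> fverts F" "B \<subseteq> fverts F" "A \<inter> B = {}"
    "conn_set F A" "conn_set F B" "flab F ` P \<subseteq> A" "flab F ` Q \<subseteq> B"
    using sepE[OF s] .
  obtain a b where ab: "a \<in> A" "b \<in> B" using AB ne by blast
  let ?r = "\<lambda>v. if v \<in> A then a else b"
  have r: "retraction F (A \<union> B) ?r"
    unfolding retraction_def
  proof
    fix v assume v: "v \<in> A \<union> B"
    have "joined F {w \<in> A \<union> B. ?r w = ?r v} v (?r v)"
    proof (cases "v \<in> A")
      case True
      then have "joined F A v a" using AB ab by (simp add: conn_set_def)
      then show ?thesis by (rule joined_mono[THEN back_subst[of "\<lambda>z. joined F _ v z"]]) (use True in auto)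
    next
      case False
      then have "joined F B v b" using AB ab v by (auto simp: conn_set_def)
      then show ?thesis by (rule joined_mono[THEN back_subst[of "\<lambda>z. joined F _ v z"]]) (use False AB in auto)
    qed
    then show "?r v \<in> A \<union> B \<and> ?r (?r v) = ?r v \<and> joined F {w \<in> A \<union> B. ?r w = ?r v} v (?r v)"
      using ab AB(3) by auto
  qed
  obtain r' where r': "retraction F (fverts F) r'" "\<forall>v\<in>A \<union> B. r' v = ?r v"
    "r' ` fverts F = ?r ` (A \<union> B)"
    using extend_retraction[OF conn fin _ _ r] AB ab by auto
  let ?C = "\<lambda>c. {v \<in> fverts F. r' v = c}"
  have C: "conn_set F (?C c)" for c
    by (rule conn_set_center[of _ _ c]) (use r'(1) in \<open>auto simp: retraction_def\<close>)
  show ?thesis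
  proof (rule that[of "?C a" "?C b"])
    have "r' v = a \<or> r' v = b" if "v \<in> fverts F" for v
    proof -
      have "r' v \<in> ?r ` (A \<union> B)" using that r'(3) by blast
      then show ?thesis by (auto split: if_splits)
    qed
    then show "?C a \<union> ?C b = fverts F" by blast
    show "?C a \<inter> ?C b = {}" using ab AB by auto
    show "flab F ` P \<subseteq> ?C a" "flab F ` Q \<subseteq> ?C b" 
      using AB(1-3,6,7) r'(2) by (auto simp: image_subset_iff)
  qed (rule C C)+
qed

lemma sep_insert:
  assumes wf: "wf_rep X F" and conn: "conn_set F (fverts F)" and s: "sep F P Q"
    and ne: "P \<noteq> {}" "Q \<noteq> {}" and c: "c \<in> X"
  shows "sep F (insert c P) Q \<or> sep F P (insert c Q)"
proof -
  have fin: "finite (fverts F)" and cV: "flab F c \<in> fverts F" using wf c by (auto simp: wf_rep_def)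
  obtain A B where AB: "A \<union> B = fverts F" "A \<inter> B = {}" "conn_set F A" "conn_set F B"
    "flab F ` P \<subseteq> A" "flab F ` Q \<subseteq> B" using sep_cover[OF conn fin s ne] .
  show ?thesis
  proof (cases "flab F c \<in> A")
    case True
    then have "sep F (insert c P) Q" using AB by (intro sepI[of A _ B]) auto
    then show ?thesis ..
  next
    case False
    then have "sep F P (insert c Q)" using AB cV by (intro sepI[of A _ B]) auto
    then show ?thesis ..
  qed
qed

lemma joined_crossing:
  assumes "joined F A x y" "x \<in> S" "y \<notin> S"
  shows "\<exists>p q. adj F p q \<and> p \<in> A \<and> q \<in> A \<and> p \<in> S \<and> q \<notin> S"
proof -
  have "y \<in> S \<or> (\<exists>p q. adj F p q \<and> p \<in> A \<and> q \<in> A \<and> p \<in> S \<and> q \<notin> S)"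
    using assms(1) by (induction rule: joined_induct) (use assms(2) in auto)
  then show ?thesis using assms(3) by blast
qed

text \<open>If all four corners were occupied, the two halves of the second split would be linked by two
edges, one inside each half of the first split, and these would lie on a cycle.\<close>

lemma sep_compatible:
  assumes wf: "wf_rep X F" and br: "bridged F" and conn: "conn_set F (fverts F)"
    and s: "sep F P Q" and s': "sep F P' Q'"
    and a: "a \<in> P" "a \<in> P'" and b: "b \<in> P" "b \<in> Q'"
    and c: "c \<in> Q" "c \<in> P'" and d: "d \<in> Q" "d \<in> Q'"
  shows False
proof -
  have fin: "finite (fverts F)" using wf by (simp add: wf_rep_def)
  obtain A B where AB: "A \<union> B = fverts F" "A \<inter> B = {}" "conn_set F A" "conn_set F B"
    "flab F ` P \<subseteq> A" "flab F ` Q \<subseteq> B" using sep_cover[OF conn fin s] a c by blast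
  obtain A' B' where AB': "A' \<union> B' = fverts F" "A' \<inter> B' = {}" "conn_set F A'" "conn_set F B'"
    "flab F ` P' \<subseteq> A'" "flab F ` Q' \<subseteq> B'" using sep_cover[OF conn fin s'] a b by blast
  have "joined F A (flab F a) (flab F b)" using AB(3,5) a b by (simp add: conn_set_def image_subset_iff)
  then obtain x y where xy: "adj F x y" "x \<in> A" "y \<in> A" "x \<in> A'" "y \<notin> A'"
    using joined_crossing[of F A "flab F a" "flab F b" A'] AB' a b by blast
  have "joined F B (flab F c) (flab F d)" using AB(4,6) c d by (simp add: conn_set_def image_subset_iff)
  then obtain z w where zw: "adj F z w" "z \<in> B" "w \<in> B" "z \<in> A'" "w \<notin> A'"
    using joined_crossing[of F B "flab F c" "flab F d" A'] AB' c d by blast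
  let ?R = "\<lambda>p q. adj F p q \<and> {p, q} \<noteq> {x, y}"
  have yw: "y \<in> B'" "w \<in> B'" using AB AB' xy zw by auto
  have "joined F A' x z" using AB' xy zw by (simp add: conn_set_def)
  then have 1: "?R\<^sup>*\<^sup>* x z"
    unfolding joined_def by (rule rtranclp_mono[THEN predicate2D, rotated]) (use xy in auto)
  have "x \<notin> B'" using xy(4) AB'(2) by blast
  have "joined F B' w y" using AB' yw by (simp add: conn_set_def)
  then have 2: "?R\<^sup>*\<^sup>* w y"
    unfolding joined_def by (rule rtranclp_mono[THEN predicate2D, rotated]) (use \<open>x \<notin> B'\<close> in \<open>auto simp: doubleton_eq_iff\<close>)
  have "?R z w" using xy zw AB by auto
  then have "?R\<^sup>*\<^sup>* x y" using rtranclp_via[of ?R x z w y] 1 2 by blast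
  then show False using br xy(1) unfolding bridged_def by blast
qed

lemma steps_to_fibres:
  assumes "wf_rep X F" "retraction F (fverts F) r"
    and "\<And>v. v \<in> fverts F \<Longrightarrow> \<exists>x\<in>X. r (flab F x) = r v"
  shows "\<exists>G. (tuffley_step X)\<^sup>*\<^sup>* F G \<and> fedges G = {} \<and> fverts G = r ` fverts F \<and>
     (\<forall>x\<in>X. flab G x = r (flab F x))"
  using assms
proof (induction "card (fedges F)" arbitrary: F rule: less_induct)
  case less
  note wf = less.prems(1) and ret = less.prems(2)
  have IH: "\<exists>G. (tuffley_step X)\<^sup>*\<^sup>* F' G \<and> fedges G = {} \<and> fverts G = r ` fverts F' \<and>
     (\<forall>x\<in>X. flab G x = r (flab F' x))"
    if "tuffley_step X F F'" "retraction F' (fverts F') r" "\<And>v. v \<in> fverts F' \<Longrightarrow> \<exists>x\<in>X. r (flab F' x) = r v" for F'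
    using less.hyps[OF card_edges_step[OF wf that(1)] wf_rep_step[OF wf that(1)] that(2,3)] .
  show ?case
  proof (cases "\<exists>u v. adj F u v \<and> r u = r v")
    case True
    obtain u v where uv: "adj F u v" "r u = r v" "v \<noteq> r v"
    proof -
      obtain s t where st: "adj F s t" "r s = r t" using True by blast
      show ?thesis
      proof (cases "t = r t")
        case True
        then have "s \<noteq> r s" using st by (auto simp: adj_def)
        then show ?thesis using that[of t s] st adj_sym[OF st(1)] by auto
      qed (use that st in auto)
    qed
    let ?G = "contract_edge F u v" and ?m = "merge u v"
    have rm: "r (?m w) = r w" for w using uv by (simp add: merge_def)
    have uV: "u \<in> fverts F" "v \<in> fverts F" "u \<noteq> v"
      using wf_rep_adj[OF wf uv(1)] uv(1) by (auto simp: adj_def)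
    have step: "tuffley_step X F ?G" using uv unfolding tuffley_step_def by blast
    have "retraction ?G (fverts ?G) r"
      unfolding retraction_def
    proof
      fix w assume w: "w \<in> fverts ?G"
      then have wV: "w \<in> fverts F" "w \<noteq> v" by auto
      then have rw: "r w \<in> fverts F" "r (r w) = r w" "joined F {z \<in> fverts F. r z = r w} w (r w)"
        using ret by (auto simp: retraction_def)
      have nv: "r w \<noteq> v" using rw uv by auto
      have "joined ?G {z \<in> fverts ?G. r z = r w} (?m w) (?m (r w))"
      proof (rule joined_map[OF rw(3)])
        fix x y assume xy: "adj F x y" "x \<in> {z \<in> fverts F. r z = r w}" "y \<in> {z \<in> fverts F. r z = r w}"
        show "joined ?G {z \<in> fverts ?G. r z = r w} (?m x) (?m y)"
        proof (cases "{x, y} = {u, v}")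
          case True
          then have "?m x = ?m y" by (simp add: merge_eq_iff)
          then show ?thesis by simp
        next
          case False
          have "?m x \<in> fverts ?G" "?m y \<in> fverts ?G" using xy uV by (auto simp: merge_def)
          then show ?thesis using adj_contractI[OF xy(1) False] xy rm by (intro joined_step) auto
        qed
      qed
      then show "r w \<in> fverts ?G \<and> r (r w) = r w \<and> joined ?G {z \<in> fverts ?G. r z = r w} w (r w)"
        using rw nv wV by (auto simp: merge_def)
    qed
    moreover have "\<exists>x\<in>X. r (flab ?G x) = r w" if "w \<in> fverts ?G" for w
      using less.prems(3)[of w] that by (auto simp: rm)
    ultimately obtain H where H: "(tuffley_step X)\<^sup>*\<^sup>* ?G H" "fedges H = {}" "fverts H = r ` fverts ?G"
      "\<forall>x\<in>X. flab H x = r (flab ?G x)" using IH[OF step] by blast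
    have "r w \<in> r ` fverts ?G" if "w \<in> fverts F" for w
      using that uV uv(2) by (intro image_eqI[where x = "?m w"]) (auto simp: rm merge_def)
    then have "r ` fverts ?G = r ` fverts F" by auto
    then show ?thesis using H converse_rtranclp_into_rtranclp[of "tuffley_step X", OF step H(1)]
      by (intro exI[of _ H]) (auto simp: rm)
  next
    case False
    have id: "r w = w" if w: "w \<in> fverts F" for w
    proof -
      have "joined F {z \<in> fverts F. r z = r w} w (r w)" using ret w by (auto simp: retraction_def)
      then show ?thesis
      proof (induction rule: joined_induct)
        case (step y z)
        then have "r y = r z" by simp
        then show ?case using False step.hyps(2) by blast
      qed simp
    qed
    have lab: "w \<in> flab F ` X" if "w \<in> fverts F" for w
    proof -
      obtain x where "x \<in> X" "r (flab F x) = r w" using less.prems(3) \<open>w \<in> fverts F\<close> by blast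
      moreover have "flab F x \<in> fverts F" using wf \<open>x \<in> X\<close> by (auto simp: wf_rep_def)
      ultimately show ?thesis using id that by auto
    qed
    show ?thesis
    proof (cases "fedges F = {}")
      case True
      then show ?thesis using id wf by (intro exI[of _ F]) (auto simp: wf_rep_def)
    next
      case False
      then obtain e where e: "e \<in> fedges F" by blast
      obtain u v where uv: "e = {u, v}" "u \<noteq> v" "adj F u v" using wf_rep_edgeE[OF wf e] .
      let ?G = "delete_edge F u v"
      have "safe_vertex X F u" "safe_vertex X F v"
        using lab wf_rep_adj[OF wf uv(3)] by (simp_all add: safe_vertex_def)
      then have step: "tuffley_step X F ?G" unfolding tuffley_step_def using uv(3) by metis
      have "retraction ?G (fverts ?G) r" using id by (auto simp: retraction_def)
      then obtain H where H: "(tuffley_step X)\<^sup>*\<^sup>* ?G H" "fedges H = {}" "fverts H = r ` fverts ?G"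
        "\<forall>x\<in>X. flab H x = r (flab ?G x)" using IH[OF step] less.prems(3) unfolding delete_sel by metis
      then show ?thesis using converse_rtranclp_into_rtranclp[of "tuffley_step X", OF step H(1)]
        by (intro exI[of _ H]) auto
    qed
  qed
qed

section \<open>Cells of the Tuffley poset\<close>

definition cls :: "'x set \<Rightarrow> 'x forest_rep \<Rightarrow> 'x forest_rep set" where
  "cls X F = {G. forest_iso X F G}"

definition edge_count :: "'x forest_rep set \<Rightarrow> nat" where
  "edge_count c = card (fedges (SOME F. F \<in> c))"

definition cell_sep :: "'x forest_rep set \<Rightarrow> 'x set \<Rightarrow> 'x set \<Rightarrow> bool" where
  "cell_sep c P Q \<longleftrightarrow> (\<exists>F\<in>c. sep F P Q)"

lemma is_X_forest_wf: "is_X_forest X F \<Longrightarrow> wf_rep X F"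
  by (simp add: is_X_forest_altdef)

lemma tuffley_poset_cls: "tuffley_poset X = {cls X F | F. is_X_forest X F}"
  by (simp add: tuffley_poset_def cls_def)

lemma cls_self: "F \<in> cls X F"
  by (simp add: cls_def forest_iso_refl)

lemma cls_in_poset: "is_X_forest X F \<Longrightarrow> cls X F \<in> tuffley_poset X"
  unfolding tuffley_poset_cls by blast

lemma cls_eq:
  assumes "wf_rep X F" "G \<in> cls X F"
  shows "cls X G = cls X F"
proof -
  have FG: "forest_iso X F G" using assms by (simp add: cls_def)
  have GF: "forest_iso X G F" using forest_iso_sym[OF assms(1) FG] .
  have "forest_iso X G H \<longleftrightarrow> forest_iso X F H" for H
    using forest_iso_trans[OF FG, of H] forest_iso_trans[OF GF, of H] by iprover
  then show ?thesis by (simp add: cls_def)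
qed

lemma edge_count_cls:
  assumes "wf_rep X F"
  shows "edge_count (cls X F) = card (fedges F)"
proof -
  have "(SOME G. G \<in> cls X F) \<in> cls X F" by (rule someI[of "\<lambda>G. G \<in> cls X F", OF cls_self])
  then have "forest_iso X F (SOME G. G \<in> cls X F)" unfolding cls_def by (rule CollectD)
  from forest_iso_card_edges[OF assms this] show ?thesis unfolding edge_count_def .
qed

lemma poset_memD:
  assumes "c \<in> tuffley_poset X" "F \<in> c"
  shows "wf_rep X F" "c = cls X F" "card (fedges F) = edge_count c"
proof -
  obtain F0 where F0: "is_X_forest X F0" "c = cls X F0" using assms by (auto simp: tuffley_poset_cls)
  have wf0: "wf_rep X F0" using F0 by (simp add: is_X_forest_wf)
  show wf: "wf_rep X F" using forest_iso_wf[OF wf0] assms F0 by (auto simp: cls_def)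
  show c: "c = cls X F" using cls_eq[OF wf0, of F] assms F0 by simp
  show "card (fedges F) = edge_count c" using edge_count_cls[OF wf] c by simp
qed

lemma cell_sep_rep:
  assumes "c \<in> tuffley_poset X" "F \<in> c" "P \<subseteq> X" "Q \<subseteq> X" "cell_sep c P Q"
  shows "sep F P Q"
proof -
  obtain G where G: "G \<in> c" "sep G P Q" using assms by (auto simp: cell_sep_def)
  have "forest_iso X G F" using poset_memD(2)[OF assms(1) G(1)] assms(2) by (simp add: cls_def)
  then show ?thesis using sep_iso[OF poset_memD(1)[OF assms(1) G(1)]] assms G by blast
qed

lemma tuffley_le_edge_count:
  assumes "c \<in> tuffley_poset X" "c' \<in> tuffley_poset X" "tuffley_le X c' c"
  shows "c' = c \<or> edge_count c' < edge_count c"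
proof -
  obtain F G where FG: "F \<in> c" "G \<in> c'" "(tuffley_step X)\<^sup>*\<^sup>* F G"
    using assms(3) by (auto simp: tuffley_le_def)
  note F = poset_memD[OF assms(1) FG(1)] and G = poset_memD[OF assms(2) FG(2)]
  show ?thesis using card_edges_steps[OF FG(3) F(1)] F G by auto
qed

lemma tuffley_le_cell_sep:
  assumes "c \<in> tuffley_poset X" "c' \<in> tuffley_poset X" "tuffley_le X c' c"
    and "P \<subseteq> X" "Q \<subseteq> X" "cell_sep c' P Q"
  shows "cell_sep c P Q"
proof -
  obtain F G where FG: "F \<in> c" "G \<in> c'" "(tuffley_step X)\<^sup>*\<^sup>* F G"
    using assms(3) by (auto simp: tuffley_le_def)
  have "sep G P Q" using cell_sep_rep[OF assms(2) FG(2) assms(4-6)] .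
  then have "sep F P Q" using sep_steps[OF FG(3) poset_memD(1)[OF assms(1) FG(1)]] assms by blast
  then show ?thesis using FG by (auto simp: cell_sep_def)
qed

lemma edge_count_bound:
  assumes "finite X" "c \<in> tuffley_poset X"
  shows "edge_count c \<le> 3 * card X"
  using assms card_edges_bound by (auto simp: tuffley_poset_cls edge_count_cls is_X_forest_wf)

lemma maximal_above:
  assumes "finite X" "K \<subseteq> tuffley_poset X" "c \<in> K"
  shows "\<exists>m\<in>K. (\<forall>g\<in>K. tuffley_le X m g \<longrightarrow> g = m) \<and> edge_count c \<le> edge_count m \<and>
    (\<forall>P Q. P \<subseteq> X \<longrightarrow> Q \<subseteq> X \<longrightarrow> cell_sep c P Q \<longrightarrow> cell_sep m P Q)"
  using assms(3)
proof (induction "3 * card X - edge_count c" arbitrary: c rule: less_induct)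
  case less
  show ?case
  proof (cases "\<forall>g\<in>K. tuffley_le X c g \<longrightarrow> g = c")
    case True
    then show ?thesis using less.prems by (intro bexI[of _ c]) auto
  next
    case False
    then obtain g where g: "g \<in> K" "tuffley_le X c g" "g \<noteq> c" by blast
    have P: "c \<in> tuffley_poset X" "g \<in> tuffley_poset X" using g less.prems assms(2) by auto
    have lt: "edge_count c < edge_count g" using tuffley_le_edge_count[OF P(2,1) g(2)] g(3) by auto
    have "edge_count g \<le> 3 * card X" using edge_count_bound[OF assms(1) P(2)] .
    then have "3 * card X - edge_count g < 3 * card X - edge_count c" using lt by linarith
    from less.hyps[OF this g(1)] obtain m where m: "m \<in> K" "\<forall>h\<in>K. tuffley_le X m h \<longrightarrow> h = m"
      "edge_count g \<le> edge_count m"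
      "\<forall>P Q. P \<subseteq> X \<longrightarrow> Q \<subseteq> X \<longrightarrow> cell_sep g P Q \<longrightarrow> cell_sep m P Q" by blast
    have "\<forall>P Q. P \<subseteq> X \<longrightarrow> Q \<subseteq> X \<longrightarrow> cell_sep c P Q \<longrightarrow> cell_sep m P Q"
      using m(4) tuffley_le_cell_sep[OF P(2,1) g(2)] by blast
    then show ?thesis using m lt by (intro bexI[of _ m]) auto
  qed
qed

lemma sorted_wrt_less_length:
  fixes f :: "'a \<Rightarrow> nat"
  assumes "sorted_wrt (\<lambda>a b. f a < f b) cs" "cs \<noteq> []"
  shows "length cs \<le> Suc (f (last cs))"
  using assms
proof (induction cs rule: rev_induct)
  case (snoc c cs)
  show ?case
  proof (cases "cs = []")
    case False
    then have "f (last cs) < f c" using snoc.prems by (simp add: sorted_wrt_append)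
    moreover have "length cs \<le> Suc (f (last cs))" using snoc False by (simp add: sorted_wrt_append)
    ultimately show ?thesis by simp
  qed simp
qed simp

lemma contraction_chain:
  assumes "is_X_forest X F"
  shows "\<exists>cs. length cs = Suc (card (fedges F)) \<and> set cs \<subseteq> tuffley_poset X \<and>
     sorted_wrt (\<lambda>a b. tuffley_le X a b \<and> a \<noteq> b) cs \<and> last cs = cls X F \<and>
     (\<forall>c\<in>set cs. \<exists>G\<in>c. (tuffley_step X)\<^sup>*\<^sup>* F G)"
  using assms
proof (induction "card (fedges F)" arbitrary: F)
  case 0
  then show ?case
    by (intro exI[of _ "[cls X F]"]) (auto simp: cls_in_poset cls_self intro!: bexI[of _ F])
next
  case (Suc n)
  have wf: "wf_rep X F" and br: "bridged F" using Suc.prems by (auto simp: is_X_forest_altdef)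
  have "fedges F \<noteq> {}" using Suc.hyps(2) by (metis Zero_not_Suc card.empty)
  then obtain e where e: "e \<in> fedges F" by blast
  obtain u v where uv: "e = {u, v}" "u \<noteq> v" "adj F u v" using wf_rep_edgeE[OF wf e] .
  let ?G = "contract_edge F u v"
  have step: "tuffley_step X F ?G" using uv unfolding tuffley_step_def by blast
  have cG: "n = card (fedges ?G)" using card_edges_contract[OF wf br uv(3)] Suc.hyps(2) by linarith
  have G: "is_X_forest X ?G" using is_X_forest_contract[OF Suc.prems uv(3)] .
  obtain cs where cs: "length cs = Suc (card (fedges ?G))" "set cs \<subseteq> tuffley_poset X"
     "sorted_wrt (\<lambda>a b. tuffley_le X a b \<and> a \<noteq> b) cs" "last cs = cls X ?G"
     "\<forall>c\<in>set cs. \<exists>H\<in>c. (tuffley_step X)\<^sup>*\<^sup>* ?G H"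
    using Suc.hyps(1)[OF cG G] by blast
  have below: "\<exists>H\<in>c. (tuffley_step X)\<^sup>*\<^sup>* F H" if "c \<in> set cs" for c
    using cs(5) that converse_rtranclp_into_rtranclp[of "tuffley_step X", OF step] by blast
  have le: "tuffley_le X c (cls X F) \<and> c \<noteq> cls X F" if c: "c \<in> set cs" for c
  proof -
    obtain H where H: "H \<in> c" "(tuffley_step X)\<^sup>*\<^sup>* ?G H" using cs(5) c by blast
    have cP: "c \<in> tuffley_poset X" using c cs(2) by blast
    have "edge_count c = card (fedges H)" using poset_memD(3)[OF cP H(1)] by simp
    also have "\<dots> \<le> card (fedges ?G)" using card_edges_steps[OF H(2) is_X_forest_wf[OF G]] by auto
    also have "\<dots> < card (fedges F)" using cG Suc.hyps(2) by linarith
    also have "\<dots> = edge_count (cls X F)" using edge_count_cls[OF wf] by simp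
    finally have "c \<noteq> cls X F" by blast
    moreover have "tuffley_le X c (cls X F)" using below[OF c] cls_self unfolding tuffley_le_def by blast
    ultimately show ?thesis by blast
  qed
  have len: "length (cs @ [cls X F]) = Suc (card (fedges F))" using cs(1) cG Suc.hyps(2) by simp
  show ?case
    by (rule exI[of _ "cs @ [cls X F]"])
       (use len cs(2,3) le below cls_in_poset[OF Suc.prems] cls_self[of F X] in
        \<open>auto simp: sorted_wrt_append\<close>)
qed

lemma cell_dim_eq:
  assumes "c \<in> tuffley_poset X"
  shows "cell_dim (tuffley_poset X) (tuffley_le X) c = edge_count c"
proof -
  obtain F where F: "is_X_forest X F" "c = cls X F" using assms by (auto simp: tuffley_poset_cls)
  let ?L = "{length cs | cs. cs \<noteq> [] \<and> set cs \<subseteq> tuffley_poset X \<and>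
    sorted_wrt (\<lambda>a b. tuffley_le X a b \<and> a \<noteq> b) cs \<and> last cs = c}"
  have ec: "edge_count c = card (fedges F)" using F by (simp add: edge_count_cls is_X_forest_wf)
  have le: "n \<le> Suc (edge_count c)" if n: "n \<in> ?L" for n
  proof -
    obtain cs where cs: "n = length cs" "cs \<noteq> []" "set cs \<subseteq> tuffley_poset X"
      "sorted_wrt (\<lambda>a b. tuffley_le X a b \<and> a \<noteq> b) cs" "last cs = c" using n by blast
    have "sorted_wrt (\<lambda>a b. edge_count a < edge_count b) cs"
      by (rule sorted_wrt_mono_rel[OF _ cs(4)]) (use cs(3) tuffley_le_edge_count in blast)
    then show ?thesis using sorted_wrt_less_length[of edge_count cs] cs by simp
  qed
  obtain cs where cs: "length cs = Suc (card (fedges F))" "set cs \<subseteq> tuffley_poset X"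
     "sorted_wrt (\<lambda>a b. tuffley_le X a b \<and> a \<noteq> b) cs" "last cs = cls X F"
    using contraction_chain[OF F(1)] by blast
  have "cs \<noteq> []" using cs(1) by auto
  then have mem: "Suc (edge_count c) \<in> ?L" using cs ec F(2) by (intro CollectI exI[of _ cs]) auto
  have "finite ?L" using le by (intro finite_subset[of ?L "{..Suc (edge_count c)}"]) auto
  then have "Max ?L = Suc (edge_count c)" using mem le by (intro Max_eqI) auto
  then show ?thesis unfolding cell_dim_def by simp
qed

definition zero_forest :: "'x set \<Rightarrow> ('x \<Rightarrow> nat) \<Rightarrow> 'x forest_rep" where
  "zero_forest X f = (f ` X, {}, f)"

lemma zero_forest_sel [simp]:
  "fverts (zero_forest X f) = f ` X" "fedges (zero_forest X f) = {}" "flab (zero_forest X f) = f"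
  by (auto simp: zero_forest_def)

lemma is_X_forest_zero: "finite X \<Longrightarrow> is_X_forest X (zero_forest X f)"
  by (auto simp: is_X_forest_altdef wf_rep_def bridged_def adj_def)

lemma sep_zero_forest:
  assumes "\<forall>x\<in>P. f x = p" "\<forall>x\<in>Q. f x = q" "p \<noteq> q" "P \<subseteq> X" "Q \<subseteq> X"
  shows "sep (zero_forest X f) P Q"
  by (rule sepI[of "{p} \<inter> f ` X" _ "{q} \<inter> f ` X"]) (use assms in \<open>auto simp: conn_set_def\<close>)

lemma edgeless_iso:
  assumes "fedges G = {}" "fverts G = flab G ` X"
    and ker: "\<And>x y. x \<in> X \<Longrightarrow> y \<in> X \<Longrightarrow> f x = f y \<longleftrightarrow> flab G x = flab G y"
  shows "forest_iso X (zero_forest X f) G"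
proof -
  define h where "h n = flab G (SOME x. x \<in> X \<and> f x = n)" for n
  have h: "h (f x) = flab G x" if "x \<in> X" for x
  proof -
    have "(SOME y. y \<in> X \<and> f y = f x) \<in> X \<and> f (SOME y. y \<in> X \<and> f y = f x) = f x"
      by (rule someI[of _ x]) (use that in simp)
    then show ?thesis unfolding h_def using ker that by blast
  qed
  have "inj_on h (f ` X)" using h ker by (auto simp: inj_on_def)
  moreover have "h ` f ` X = flab G ` X" using h by (auto simp: image_image)
  ultimately have "bij_betw h (f ` X) (fverts G)" using assms by (simp add: bij_betw_def)
  then show ?thesis unfolding forest_iso_def using h assms(1) by auto
qed

lemma bridged_add_edge:
  assumes br: "bridged F" and npq: "\<not> (adj F)\<^sup>*\<^sup>* p q"
    and adj: "\<And>x y. adj F' x y \<longleftrightarrow> adj F x y \<or> {x, y} = {p, q}"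
  shows "bridged F'"
  unfolding bridged_def
proof (intro allI impI notI)
  fix u v
  let ?R' = "\<lambda>x y. adj F' x y \<and> {x, y} \<noteq> {u, v}"
  let ?R = "\<lambda>x y. adj F x y \<and> {x, y} \<noteq> {u, v}"
  assume uv: "adj F' u v" and path: "?R'\<^sup>*\<^sup>* u v"
  have sym: "(adj F)\<^sup>*\<^sup>* y x" if "(adj F)\<^sup>*\<^sup>* x y" for x y
    using that by (rule rtranclp_sym) (rule adj_sym)
  have nst: "\<not> (adj F)\<^sup>*\<^sup>* s t" if "{s, t} = {p, q}" for s t
    using that npq sym by (auto simp: doubleton_eq_iff)
  have RF: "(adj F)\<^sup>*\<^sup>* x y" if "?R\<^sup>*\<^sup>* x y" for x y
    using that by (rule rtranclp_mono[THEN predicate2D, rotated]) auto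
  show False
  proof (cases "{u, v} = {p, q}")
    case True
    have "(adj F)\<^sup>*\<^sup>* u v" using path
      by (rule rtranclp_mono[THEN predicate2D, rotated]) (use True adj in auto)
    then show False using nst True by blast
  next
    case False
    then have uvF: "adj F u v" using uv adj by blast
    have "?R\<^sup>*\<^sup>* u x \<or> (\<exists>s t. {s, t} = {p, q} \<and> ?R\<^sup>*\<^sup>* u s \<and> ?R\<^sup>*\<^sup>* t x)" if "?R'\<^sup>*\<^sup>* u x" for x
      using that
    proof (induction rule: rtranclp_induct)
      case (step x y)
      show ?case
      proof (cases "adj F x y")
        case True
        then have "?R x y" using step by blast
        then have "?R\<^sup>*\<^sup>* z y" if "?R\<^sup>*\<^sup>* z x" for z
          using that rtranclp.rtrancl_into_rtrancl[of ?R z x y] by blast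
        then show ?thesis using step.IH by blast
      next
        case False
        then have xy: "{x, y} = {p, q}" using step adj by blast
        from step.IH show ?thesis
        proof
          assume "?R\<^sup>*\<^sup>* u x"
          then show ?thesis using xy rtranclp.rtrancl_refl[of ?R y] by blast
        next
          assume "\<exists>s t. {s, t} = {p, q} \<and> ?R\<^sup>*\<^sup>* u s \<and> ?R\<^sup>*\<^sup>* t x"
          then obtain s t where st: "{s, t} = {p, q}" "?R\<^sup>*\<^sup>* u s" "?R\<^sup>*\<^sup>* t x" by blast
          have "\<not> (adj F)\<^sup>*\<^sup>* t s" using nst[of t s] st(1) by (simp add: insert_commute)
          then have "x \<noteq> s" using RF[OF st(3)] by blast
          then have "y = s" using st(1) xy by (auto simp: doubleton_eq_iff)
          then show ?thesis using st(2) by blast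
        qed
      qed
    qed simp
    with path consider "?R\<^sup>*\<^sup>* u v" | s t where "{s, t} = {p, q}" "?R\<^sup>*\<^sup>* u s" "?R\<^sup>*\<^sup>* t v" by blast
    then show False
    proof cases
      case 1
      then show False using br uvF unfolding bridged_def by blast
    next
      case (2 s t)
      have "(adj F)\<^sup>*\<^sup>* s t"
        using rtranclp_via[of "adj F" s u v t] sym RF 2(2,3) uvF by blast
      then show False using nst 2(1) by blast
    qed
  qed
qed

lemma join_components:
  assumes F: "is_X_forest X F" and nc: "\<not> conn_set F (fverts F)"
  obtains F' x y where "is_X_forest X F'" "tuffley_step X F' F"
    "card (fedges F') = Suc (card (fedges F))" "x \<in> X" "y \<in> X" "adj F' (flab F' x) (flab F' y)"
proof -
  have wf: "wf_rep X F" and br: "bridged F" using F by (auto simp: is_X_forest_altdef)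
  have sym: "(adj F)\<^sup>*\<^sup>* y x" if "(adj F)\<^sup>*\<^sup>* x y" for x y
    using that by (rule rtranclp_sym) (rule adj_sym)
  obtain p q where pq: "p \<in> fverts F" "q \<in> fverts F" "\<not> (adj F)\<^sup>*\<^sup>* p q"
    using nc joined_verts[OF wf] by (auto simp: conn_set_def)
  obtain x y where x: "x \<in> X" "(adj F)\<^sup>*\<^sup>* p (flab F x)" and y: "y \<in> X" "(adj F)\<^sup>*\<^sup>* q (flab F y)"
    using F pq by (metis is_X_forest_altdef)
  let ?u = "flab F x" and ?v = "flab F y"
  have nuv: "\<not> (adj F)\<^sup>*\<^sup>* ?u ?v" using pq(3) x y sym rtranclp_trans[of "adj F"] by metis
  have ne: "?u \<noteq> ?v" using nuv by auto
  have new: "{?u, ?v} \<notin> fedges F" using nuv ne by (auto simp: adj_def)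
  have V: "?u \<in> fverts F" "?v \<in> fverts F" using wf x y by (auto simp: wf_rep_def)
  let ?F = "(fverts F, insert {?u, ?v} (fedges F), flab F)"
  have adj: "adj ?F a b \<longleftrightarrow> adj F a b \<or> {a, b} = {?u, ?v}" for a b
    using ne by (auto simp: adj_def)
  have fE: "finite (fedges F)" using wf by (rule wf_rep_finite_edges)
  have wf': "wf_rep X ?F" using wf V ne by (auto simp: wf_rep_def)
  have br': "bridged ?F" by (rule bridged_add_edge[OF br nuv adj])
  have mono: "(adj ?F)\<^sup>*\<^sup>* a b" if "(adj F)\<^sup>*\<^sup>* a b" for a b
    using that by (rule rtranclp_mono[THEN predicate2D, rotated]) (use adj in auto)
  have deg: "vdegree F w \<le> vdegree ?F w" for w
    unfolding vdegree_def by (rule card_mono) (use fE in auto)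
  have "is_X_forest X ?F"
    unfolding is_X_forest_altdef
  proof (intro conjI ballI impI)
    fix w assume w: "w \<in> fverts ?F"
    then obtain z where "z \<in> X" "(adj F)\<^sup>*\<^sup>* w (flab F z)" using F by (auto simp: is_X_forest_altdef)
    then show "\<exists>z\<in>X. (adj ?F)\<^sup>*\<^sup>* w (flab ?F z)" using mono by auto
    assume "w \<notin> flab ?F ` X"
    then have "3 \<le> vdegree F w" using F w by (auto simp: is_X_forest_altdef)
    then show "3 \<le> vdegree ?F w" using deg[of w] by linarith
  qed (rule wf' br')+
  moreover have "delete_edge ?F ?u ?v = F"
    using new by (simp add: delete_edge_def fverts_def fedges_def flab_def)
  then have "tuffley_step X ?F F"
    unfolding tuffley_step_def safe_vertex_def using adj x y by (intro exI[of _ ?u] exI[of _ ?v]) auto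
  moreover have "card (fedges ?F) = Suc (card (fedges F))" using new fE by simp
  moreover have "adj ?F (flab ?F x) (flab ?F y)" using adj by simp
  ultimately show ?thesis using that x(1) y(1) by blast
qed

lemma pull_out_label:
  assumes F: "is_X_forest X F" and x: "x \<in> X"
    and c: "(\<exists>y\<in>X. y \<noteq> x \<and> flab F y = flab F x) \<or> vdegree F (flab F x) \<ge> 2"
  obtains F' G where "is_X_forest X F'" "tuffley_step X F' G" "forest_iso X F G"
    "card (fedges F') = Suc (card (fedges F))"
proof -
  have wf: "wf_rep X F" and br: "bridged F" using F by (auto simp: is_X_forest_altdef)
  have fE: "finite (fedges F)" using wf by (rule wf_rep_finite_edges)
  let ?v = "flab F x"
  have lab: "flab F y \<in> fverts F" if "y \<in> X" for y using wf that by (auto simp: wf_rep_def)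
  obtain w where w: "w \<notin> fverts F" using wf ex_new_if_finite[of "fverts F"] by (auto simp: wf_rep_def)
  have vw: "?v \<noteq> w" using lab[OF x] w by auto
  have eV: "e \<subseteq> fverts F" if "e \<in> fedges F" for e using wf that by (auto simp: wf_rep_def)
  have we: "w \<notin> e" if "e \<in> fedges F" for e using eV[OF that] w by auto
  then have new: "{?v, w} \<notin> fedges F" by blast
  let ?F = "(insert w (fverts F), insert {?v, w} (fedges F), (flab F)(x := w))"
  let ?G = "contract_edge ?F ?v w"
  have adj: "adj ?F a b \<longleftrightarrow> adj F a b \<or> {a, b} = {?v, w}" for a b
    using vw by (auto simp: adj_def)
  have nw: "\<not> (adj F)\<^sup>*\<^sup>* ?v w"
  proof
    assume "(adj F)\<^sup>*\<^sup>* ?v w"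
    then show False
    proof (cases rule: rtranclp.cases)
      case (rtrancl_into_rtrancl b)
      then show False using wf_rep_adj[OF wf] w by blast
    qed (use vw in simp)
  qed
  have wf': "wf_rep X ?F" using wf lab[OF x] vw by (auto simp: wf_rep_def)
  have br': "bridged ?F" by (rule bridged_add_edge[OF br nw adj])
  have mono: "(adj ?F)\<^sup>*\<^sup>* a b" if "(adj F)\<^sup>*\<^sup>* a b" for a b
    using that by (rule rtranclp_mono[THEN predicate2D, rotated]) (use adj in auto)
  have vw': "(adj ?F)\<^sup>*\<^sup>* ?v w" using adj by (intro r_into_rtranclp) simp
  have reach: "\<exists>z\<in>X. (adj ?F)\<^sup>*\<^sup>* a (flab ?F z)" if a: "a \<in> fverts F" for a
  proof -
    obtain z where z: "z \<in> X" "(adj F)\<^sup>*\<^sup>* a (flab F z)" using F a by (auto simp: is_X_forest_altdef)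
    show ?thesis
    proof (cases "z = x")
      case True
      then have "(adj ?F)\<^sup>*\<^sup>* a w" using mono[OF z(2)] vw' by (simp add: rtranclp_trans[of "adj ?F"])
      then show ?thesis using x by (intro bexI[of _ x]) auto
    next
      case False
      then show ?thesis using mono[OF z(2)] z(1) by (intro bexI[of _ z]) auto
    qed
  qed
  have deg: "vdegree F a \<le> vdegree ?F a" for a
    unfolding vdegree_def by (rule card_mono) (use fE in auto)
  have degv: "vdegree ?F ?v = Suc (vdegree F ?v)"
  proof -
    have "{e \<in> fedges ?F. ?v \<in> e} = insert {?v, w} {e \<in> fedges F. ?v \<in> e}" by auto
    then show ?thesis unfolding vdegree_def using new fE by simp
  qed
  have "is_X_forest X ?F"
    unfolding is_X_forest_altdef
  proof (intro conjI ballI impI)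
    fix a assume a: "a \<in> fverts ?F"
    show "\<exists>z\<in>X. (adj ?F)\<^sup>*\<^sup>* a (flab ?F z)"
    proof (cases "a = w")
      case True
      then show ?thesis using x by (intro bexI[of _ x]) auto
    qed (use reach a in auto)
    assume nl: "a \<notin> flab ?F ` X"
    have "a \<noteq> w" using nl x by auto
    then have aV: "a \<in> fverts F" using a by auto
    show "3 \<le> vdegree ?F a"
    proof (cases "a = ?v")
      case True
      have "\<not> (\<exists>y\<in>X. y \<noteq> x \<and> flab F y = flab F x)"
      proof
        assume "\<exists>y\<in>X. y \<noteq> x \<and> flab F y = flab F x"
        then obtain y where "y \<in> X" "y \<noteq> x" "flab F y = flab F x" by blast
        then have "flab ?F y = a" using True by simp
        then show False using nl \<open>y \<in> X\<close> by blast
      qed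
      then have "vdegree F ?v \<ge> 2" using c by blast
      then show ?thesis unfolding True degv by linarith
    next
      case False
      have "a \<noteq> flab F y" if "y \<in> X" for y
      proof (cases "y = x")
        case False
        then have "flab ?F y = flab F y" by simp
        then show ?thesis using nl that by (metis imageI)
      qed (use \<open>a \<noteq> ?v\<close> in simp)
      then have "3 \<le> vdegree F a" using F aV by (auto simp: is_X_forest_altdef)
      then show ?thesis using deg[of a] by linarith
    qed
  qed (rule wf' br')+
  moreover have "tuffley_step X ?F ?G" unfolding tuffley_step_def using adj by blast
  moreover have "forest_iso X F ?G"
  proof -
    have "merge ?v w ` e = e" if "e \<in> fedges F" for e
      using we[OF that] by (force simp: merge_def)
    moreover have "insert {?v, w} (fedges F) - {{?v, w}} = fedges F" using new by simp
    ultimately have "fedges ?G = fedges F" by simp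
    moreover have "fverts ?G = fverts F" using w by simp
    moreover have "flab ?G y = flab F y" if "y \<in> X" for y
      using lab[OF that] w by (auto simp: merge_def)
    ultimately show ?thesis unfolding forest_iso_def by (intro exI[of _ id]) simp
  qed
  moreover have "card (fedges ?F) = Suc (card (fedges F))" using new fE by simp
  ultimately show ?thesis using that by blast
qed

lemma adj_unique:
  assumes "wf_rep X F" "vdegree F a \<le> 1" "adj F a b" "adj F a b'"
  shows "b' = b"
proof -
  have "card {e \<in> fedges F. a \<in> e} \<le> Suc 0" using assms(2) by (simp add: vdegree_def)
  moreover have "finite {e \<in> fedges F. a \<in> e}" using wf_rep_finite_edges[OF assms(1)] by simp
  moreover have "{a, b} \<in> {e \<in> fedges F. a \<in> e}" "{a, b'} \<in> {e \<in> fedges F. a \<in> e}"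
    using assms(3,4) by (auto simp: adj_def)
  ultimately have "{a, b} = {a, b'}" using card_le_Suc0_iff_eq by metis
  then show ?thesis using assms(3) by (auto simp: doubleton_eq_iff)
qed

definition spread :: "'x set \<Rightarrow> 'x forest_rep \<Rightarrow> bool" where
  "spread X F \<longleftrightarrow> conn_set F (fverts F) \<and> inj_on (flab F) X \<and> (\<forall>x\<in>X. vdegree F (flab F x) \<le> 1)"

lemma not_spread_extend:
  assumes F: "is_X_forest X F" and "\<not> spread X F"
  shows "\<exists>F'. is_X_forest X F' \<and> card (fedges F') = Suc (card (fedges F))"
proof (cases "conn_set F (fverts F)")
  case False
  then show ?thesis using join_components[OF F] by metis
next
  case True
  then obtain x where "x \<in> X" "(\<exists>y\<in>X. y \<noteq> x \<and> flab F y = flab F x) \<or> vdegree F (flab F x) \<ge> 2"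
    using assms(2) unfolding spread_def inj_on_def by (metis Suc_1 not_less_eq_eq)
  then show ?thesis using pull_out_label[OF F] by metis
qed

lemma disconnected_extend:
  assumes F: "is_X_forest X F" and nc: "\<not> conn_set F (fverts F)" and X: "card X \<ge> 3"
  shows "\<exists>F'. is_X_forest X F' \<and> card (fedges F') = Suc (Suc (card (fedges F)))"
proof -
  obtain F' x y where F': "is_X_forest X F'" "card (fedges F') = Suc (card (fedges F))"
    "x \<in> X" "y \<in> X" "adj F' (flab F' x) (flab F' y)" using join_components[OF F nc] by metis
  let ?u = "flab F' x" and ?v = "flab F' y"
  have "\<not> spread X F'"
  proof
    assume g: "spread X F'"
    have wf: "wf_rep X F'" using F' by (simp add: is_X_forest_wf)
    have "card {x, y} < card X" using X by (auto simp: card_insert_if)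
    then have "\<not> X \<subseteq> {x, y}" using card_mono[of "{x, y}" X] by auto
    then obtain z where z: "z \<in> X" "z \<noteq> x" "z \<noteq> y" by blast
    have d: "vdegree F' ?u \<le> 1" "vdegree F' ?v \<le> 1" using g F' by (auto simp: spread_def)
    have "joined F' (fverts F') ?u (flab F' z)" 
      using g wf F'(3) z(1) by (simp add: spread_def conn_set_def wf_rep_def image_subset_iff)
    then have "flab F' z \<in> {?u, ?v}"
    proof (induction rule: joined_induct)
      case (step a b)
      then show ?case
        using adj_unique[OF wf d(1) F'(5)] adj_unique[OF wf d(2) adj_sym[OF F'(5)]] by auto
    qed simp
    then show False using g z F' by (auto simp: spread_def inj_on_def)
  qed
  then show ?thesis using not_spread_extend[OF F'(1)] F'(2) by auto
qed

lemma conn_set_remove_leaves: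
  assumes wf: "wf_rep X F" and A: "conn_set F A" and deg: "\<And>w. w \<in> W \<Longrightarrow> vdegree F w \<le> 1"
  shows "conn_set F (A - W)"
  unfolding conn_set_def
proof (intro ballI)
  fix x y assume x: "x \<in> A - W" and y: "y \<in> A - W"
  have "joined F A x y" using A x y by (simp add: conn_set_def)
  then have "(y \<notin> W \<longrightarrow> joined F (A - W) x y) \<and>
     (y \<in> W \<longrightarrow> (\<exists>n. n \<in> A - W \<and> adj F y n \<and> joined F (A - W) x n))"
  proof (induction rule: joined_induct)
    case (step y z)
    show ?case
    proof (cases "y \<in> W")
      case True
      then obtain n where n: "n \<in> A - W" "adj F y n" "joined F (A - W) x n" using step by blast
      then have "z = n" using adj_unique[OF wf deg[OF True]] step.hyps(2) by blast
      then show ?thesis using n by blast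
    next
      case False
      then have j: "joined F (A - W) x y" using step by blast
      show ?thesis
      proof (cases "z \<in> W")
        case True
        then show ?thesis using False j step.hyps adj_sym[OF step.hyps(2)] by blast
      next
        case z: False
        have "joined F (A - W) y z" using step.hyps False z by (intro joined_step) auto
        then show ?thesis using j z joined_trans by blast
      qed
    qed
  qed (use x in simp)
  then show "joined F (A - W) x y" using y by blast
qed

lemma zero_forest_below:
  assumes T: "is_X_forest X T" and g: "spread X T" and s: "sep T {a, b} {d, e}"
    and mem: "a \<in> X" "b \<in> X" "d \<in> X" "e \<in> X" and dist: "distinct [a, b, d, e]"
    and ker: "\<And>x y. x \<in> X \<Longrightarrow> y \<in> X \<Longrightarrow> f x = f y \<longleftrightarrow> (id(b := a, e := d)) x = (id(b := a, e := d)) y"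
  shows "tuffley_le X (cls X (zero_forest X f)) (cls X T)"
proof -
  let ?l = "flab T" and ?blk = "id(b := a, e := d)"
  have wf: "wf_rep X T" using T by (rule is_X_forest_wf)
  have fin: "finite (fverts T)" and lV: "?l ` X \<subseteq> fverts T" using wf by (auto simp: wf_rep_def)
  have conn: "conn_set T (fverts T)" and inj: "inj_on ?l X"
    and deg: "\<And>x. x \<in> X \<Longrightarrow> vdegree T (?l x) \<le> 1" using g by (auto simp: spread_def)
  have inj': "?l x = ?l y \<longleftrightarrow> x = y" if "x \<in> X" "y \<in> X" for x y using inj that by (auto simp: inj_on_def)
  obtain A B where AB: "A \<subseteq> fverts T" "B \<subseteq> fverts T" "A \<inter> B = {}"
    "conn_set T A" "conn_set T B" "?l ` {a, b} \<subseteq> A" "?l ` {d, e} \<subseteq> B" using sepE[OF s] .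
  define A0 where "A0 = A - ?l ` (X - {a, b})"
  define B0 where "B0 = B - ?l ` (X - {d, e})"
  have cA: "conn_set T A0" and cB: "conn_set T B0"
    unfolding A0_def B0_def
    by (rule conn_set_remove_leaves[OF wf AB(4)], use deg in blast,
        rule conn_set_remove_leaves[OF wf AB(5)], use deg in blast)
  have lA: "?l x \<in> A0 \<longleftrightarrow> x = a \<or> x = b" if "x \<in> X" for x
    using AB(6) that mem inj' by (auto simp: A0_def)
  have lB: "?l x \<in> B0 \<longleftrightarrow> x = d \<or> x = e" if "x \<in> X" for x
    using AB(7) that mem inj' by (auto simp: B0_def)
  have disj: "A0 \<inter> B0 = {}" using AB(3) by (auto simp: A0_def B0_def)
  let ?S = "A0 \<union> B0 \<union> ?l ` X"
  let ?r = "\<lambda>v. if v \<in> A0 then ?l a else if v \<in> B0 then ?l d else v"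
  have ret: "retraction T ?S ?r"
    unfolding retraction_def
  proof
    fix v assume v: "v \<in> ?S"
    have ad: "?l a \<in> A0" "?l d \<in> B0" "?l d \<notin> A0" using lA lB mem dist by auto
    have "joined T {w \<in> ?S. ?r w = ?r v} v (?r v)"
    proof (cases "v \<in> A0")
      case True
      then have "joined T A0 v (?l a)" using cA ad by (simp add: conn_set_def)
      then have "joined T {w \<in> ?S. ?r w = ?r v} v (?l a)" by (rule joined_mono) (use True in auto)
      then show ?thesis using True by simp
    next
      case nA: False
      show ?thesis
      proof (cases "v \<in> B0")
        case True
        then have "joined T B0 v (?l d)" using cB ad by (simp add: conn_set_def)
        then have "joined T {w \<in> ?S. ?r w = ?r v} v (?l d)"
          by (rule joined_mono) (use True disj nA in auto)
        then show ?thesis using True nA by simp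
      qed (use nA in simp)
    qed
    then show "?r v \<in> ?S \<and> ?r (?r v) = ?r v \<and> joined T {w \<in> ?S. ?r w = ?r v} v (?r v)"
      using ad v by auto
  qed
  have rl: "?r (?l x) = ?l (?blk x)" if "x \<in> X" for x
    using lA[OF that] lB[OF that] dist by auto
  have Sne: "?S \<noteq> {}" using mem by blast
  have S: "?S \<subseteq> fverts T" using AB(1,2) lV by (auto simp: A0_def B0_def)
  obtain r where r: "retraction T (fverts T) r" "\<forall>v\<in>?S. r v = ?r v" "r ` fverts T = ?r ` ?S"
    using extend_retraction[OF conn fin S Sne ret] by metis
  have rl': "r (?l x) = ?l (?blk x)" if "x \<in> X" for x using r(2) rl that by auto
  have ad: "r (?l a) = ?l a" "r (?l d) = ?l d"
    using rl'[OF mem(1)] rl'[OF mem(3)] dist by auto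
  have onS: "\<exists>x\<in>X. r (?l x) = ?r w" if w: "w \<in> ?S" for w
  proof -
    consider "w \<in> A0" | "w \<notin> A0" "w \<in> B0" | "w \<notin> A0" "w \<notin> B0" by blast
    then show ?thesis
    proof cases
      case 1
      then show ?thesis using ad(1) mem(1) by (intro bexI[of _ a]) auto
    next
      case 2
      then show ?thesis using ad(2) mem(3) by (intro bexI[of _ d]) auto
    next
      case 3
      then obtain x where x: "x \<in> X" "w = ?l x" using w by blast
      then show ?thesis using r(2) w by (intro bexI[of _ x]) auto
    qed
  qed
  have lab: "\<exists>x\<in>X. r (?l x) = r v" if "v \<in> fverts T" for v
  proof -
    have "r v \<in> ?r ` ?S" using r(3) that by (metis imageI)
    then obtain w where "w \<in> ?S" "r v = ?r w" by (rule imageE)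
    then show ?thesis using onS by metis
  qed
  have rV: "r ` fverts T = (\<lambda>x. r (?l x)) ` X"
  proof
    show "r ` fverts T \<subseteq> (\<lambda>x. r (?l x)) ` X" using lab by (force simp: image_iff)
    show "(\<lambda>x. r (?l x)) ` X \<subseteq> r ` fverts T" using lV by blast
  qed
  obtain G where G: "(tuffley_step X)\<^sup>*\<^sup>* T G" "fedges G = {}" "fverts G = r ` fverts T"
    "\<forall>x\<in>X. flab G x = r (?l x)" using steps_to_fibres[OF wf r(1) lab] by blast
  have blkX: "?blk x \<in> X" if "x \<in> X" for x using that mem by auto
  have "forest_iso X (zero_forest X f) G"
  proof (rule edgeless_iso[OF G(2)])
    show "fverts G = flab G ` X" unfolding G(3) rV using G(4) by (intro image_cong) auto
    show "f x = f y \<longleftrightarrow> flab G x = flab G y" if "x \<in> X" "y \<in> X" for x y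
      using ker[OF that] G(4) that rl' inj'[OF blkX blkX] by metis
  qed
  then have "G \<in> cls X (zero_forest X f)" by (simp add: cls_def)
  then show ?thesis unfolding tuffley_le_def using G(1) cls_self by blast
qed

section \<open>Purity and facets\<close>

lemma sep_sym: "sep F P Q \<Longrightarrow> sep F Q P"
  by (erule sepE, rule sepI) (auto simp: Int_commute)

lemma cell_sep_sym: "cell_sep c P Q \<Longrightarrow> cell_sep c Q P"
  unfolding cell_sep_def using sep_sym by blast

lemma sep_mono:
  assumes "sep F P Q" "P' \<subseteq> P" "Q' \<subseteq> Q"
  shows "sep F P' Q'"
proof -
  obtain A B where "A \<subseteq> fverts F" "B \<subseteq> fverts F" "A \<inter> B = {}" "conn_set F A" "conn_set F B"
    "flab F ` P \<subseteq> A" "flab F ` Q \<subseteq> B" using sepE[OF assms(1)] .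
  then show ?thesis using assms(2,3) by (intro sepI[of A _ B]) (auto simp: image_subset_iff)
qed

lemma cell_sep_mono: "cell_sep c P Q \<Longrightarrow> P' \<subseteq> P \<Longrightarrow> Q' \<subseteq> Q \<Longrightarrow> cell_sep c P' Q'"
  unfolding cell_sep_def using sep_mono by blast

lemma zero_cell_below:
  assumes X: "finite X" and mem: "a \<in> X" "b \<in> X" "d \<in> X" "e \<in> X" and dist: "distinct [a, b, d, e]"
  obtains z where "z \<in> tuffley_poset X" "edge_count z = 0" "cell_sep z {a, b} {d, e}"
    "\<And>T. is_X_forest X T \<Longrightarrow> spread X T \<Longrightarrow> sep T {a, b} {d, e} \<Longrightarrow> tuffley_le X z (cls X T)"
proof -
  obtain g :: "'a \<Rightarrow> nat" where g: "inj_on g X"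
    using finite_imp_inj_to_nat_seg[OF X] by blast
  let ?blk = "id(b := a, e := d)"
  define f where "f x = g (?blk x)" for x
  have blk: "?blk x \<in> X" if "x \<in> X" for x using that mem by auto
  have ker: "f x = f y \<longleftrightarrow> ?blk x = ?blk y" if "x \<in> X" "y \<in> X" for x y
    unfolding f_def using inj_on_eq_iff[OF g blk[OF that(1)] blk[OF that(2)]] .
  have F: "is_X_forest X (zero_forest X f)" using X by (rule is_X_forest_zero)
  have "g a \<noteq> g d" using inj_on_eq_iff[OF g mem(1,3)] dist by simp
  then have "sep (zero_forest X f) {a, b} {d, e}"
    using mem dist by (intro sep_zero_forest[of _ _ "g a" _ "g d"]) (auto simp: f_def)
  then have s: "cell_sep (cls X (zero_forest X f)) {a, b} {d, e}"
    unfolding cell_sep_def using cls_self by blast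
  show ?thesis
  proof (rule that[of "cls X (zero_forest X f)"])
    show "edge_count (cls X (zero_forest X f)) = 0"
      using edge_count_cls[OF is_X_forest_wf[OF F]] by simp
    show "tuffley_le X (cls X (zero_forest X f)) (cls X T)"
      if "is_X_forest X T" "spread X T" "sep T {a, b} {d, e}" for T
      by (rule zero_forest_below[OF that mem dist ker])
  qed (use s cls_in_poset[OF F] in auto)
qed

locale pure_tuffley =
  fixes X :: "'x set" and d :: nat
  assumes fin: "finite X" and card_X: "card X \<ge> 5"
    and pure: "pure_dim (tuffley_poset X) (tuffley_le X) (tuffley_poset X) d"
begin

abbreviation C where "C \<equiv> tuffley_poset X"

lemma facet_above:
  assumes "c \<in> C"
  obtains m where "m \<in> C" "edge_count m = d" "edge_count c \<le> d"
    "\<And>P Q. P \<subseteq> X \<Longrightarrow> Q \<subseteq> X \<Longrightarrow> cell_sep c P Q \<Longrightarrow> cell_sep m P Q"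
proof -
  obtain m where m: "m \<in> C" "\<forall>g\<in>C. tuffley_le X m g \<longrightarrow> g = m" "edge_count c \<le> edge_count m"
    "\<forall>P Q. P \<subseteq> X \<longrightarrow> Q \<subseteq> X \<longrightarrow> cell_sep c P Q \<longrightarrow> cell_sep m P Q"
    using maximal_above[OF fin subset_refl assms] by blast
  have "edge_count m = d" using pure m(1,2) cell_dim_eq[OF m(1)] unfolding pure_dim_def by metis
  then show ?thesis using that[of m] m by simp
qed

lemma card_edges_le_dim:
  assumes "is_X_forest X F"
  shows "card (fedges F) \<le> d"
  using facet_above[OF cls_in_poset[OF assms]] edge_count_cls[OF is_X_forest_wf[OF assms]] by metis

lemma dim_pos: "d > 0"
proof -
  let ?F = "zero_forest X (\<lambda>_. 0)"
  have F: "is_X_forest X ?F" using fin by (rule is_X_forest_zero)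
  have "\<not> inj_on (\<lambda>_. 0 :: nat) X"
  proof
    assume "inj_on (\<lambda>_. 0 :: nat) X"
    then have "card X \<le> card {0 :: nat}" by (intro card_inj_on_le[of "\<lambda>_. 0"]) auto
    then show False using card_X by simp
  qed
  then have "\<not> spread X ?F" by (simp add: spread_def)
  then obtain F' where "is_X_forest X F'" "card (fedges F') = Suc (card (fedges ?F))"
    using not_spread_extend[OF F] by blast
  then show ?thesis using card_edges_le_dim[of F'] by simp
qed

lemma facet_spread:
  assumes "is_X_forest X T" "card (fedges T) = d"
  shows "spread X T"
  using not_spread_extend[OF assms(1)] card_edges_le_dim assms(2) by (metis Suc_n_not_le_n)

lemma ridge_connected:
  assumes "is_X_forest X G" "Suc (card (fedges G)) = d"
  shows "conn_set G (fverts G)"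
proof (rule ccontr)
  assume "\<not> conn_set G (fverts G)"
  then obtain F' where "is_X_forest X F'" "card (fedges F') = Suc (Suc (card (fedges G)))"
    using disconnected_extend[OF assms(1)] card_X by auto
  then show False using card_edges_le_dim[of F'] assms(2) by simp
qed

lemma facet_rep:
  assumes "c \<in> C" "edge_count c = d"
  obtains T where "is_X_forest X T" "c = cls X T" "spread X T"
proof -
  obtain T where T: "is_X_forest X T" "c = cls X T" using assms(1) by (auto simp: tuffley_poset_cls)
  then have "card (fedges T) = d" using assms(2) edge_count_cls[OF is_X_forest_wf[OF T(1)]] by simp
  then show ?thesis using that T facet_spread by blast
qed

lemma exists_splitting_facet:
  assumes "P \<subseteq> X" "Q \<subseteq> X" "P \<inter> Q = {}"
  shows "\<exists>m\<in>C. edge_count m = d \<and> cell_sep m P Q"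
proof -
  let ?f = "\<lambda>x. if x \<in> P then 0 else 1 :: nat"
  let ?F = "zero_forest X ?f"
  have F: "is_X_forest X ?F" using fin by (rule is_X_forest_zero)
  have "sep ?F P Q" using assms by (intro sep_zero_forest[of _ _ 0 _ 1]) auto
  then have "cell_sep (cls X ?F) P Q" unfolding cell_sep_def using cls_self by blast
  then show ?thesis using facet_above[OF cls_in_poset[OF F]] assms(1,2) by metis
qed

lemma facet_cherry_compatible:
  assumes "c \<in> C" "edge_count c = d" and Y: "Y \<subseteq> X" "p \<in> Y" "q \<in> Y" "r \<in> Y" "a \<in> Y"
    and dist: "distinct [p, q, r, a]"
    and "cell_sep c {p, q} (Y - {p, q})" "cell_sep c {q, r} (Y - {q, r})"
  shows False
proof -
  obtain T where T: "is_X_forest X T" "c = cls X T" "spread X T" using facet_rep[OF assms(1,2)] .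
  have Tc: "T \<in> c" unfolding T(2) by (rule cls_self)
  have s: "sep T {p, q} (Y - {p, q})" "sep T {q, r} (Y - {q, r})"
    by (rule cell_sep_rep[OF assms(1) Tc _ _ assms(9)], use Y in auto)
       (rule cell_sep_rep[OF assms(1) Tc _ _ assms(10)], use Y in auto)
  have br: "bridged T" and conn: "conn_set T (fverts T)"
    using T(1,3) by (simp_all add: is_X_forest_altdef spread_def)
  show False
    using sep_compatible[OF is_X_forest_wf[OF T(1)] br conn s, of q p r a] dist Y by auto
qed

end

theorem theorem1:
  fixes X :: "'x set"
  assumes "finite X" and "card X \<ge> 5"
  shows "\<not> shellable_cw (tuffley_poset X) (tuffley_le X)"
proof
  assume "shellable_cw (tuffley_poset X) (tuffley_le X)"
  then obtain d fs where sh: "shelling (tuffley_poset X) (tuffley_le X) (tuffley_poset X) d fs"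
    unfolding shellable_cw_def by blast
  have "pure_dim (tuffley_poset X) (tuffley_le X) (tuffley_poset X) d"
    using sh by (cases rule: shelling.cases) auto
  then interpret pure_tuffley X d using assms by unfold_locales
  let ?le = "tuffley_le X"
  define K where "K j = bdry C ?le (fs ! j) \<inter> (\<Union>i<j. bdry C ?le (fs ! i))" for j
  obtain d' where d: "d = Suc d'" and fs: "set fs = cells_of C ?le C d"
    and K: "\<And>j. 0 < j \<Longrightarrow> j < length fs \<Longrightarrow> pure_dim C ?le (K j) d'"
    using sh dim_pos by (cases rule: shelling.cases) (auto simp: K_def)
  have fs_iff: "c \<in> set fs \<longleftrightarrow> c \<in> C \<and> edge_count c = d" for c
    unfolding fs cells_of_def using cell_dim_eq by auto
  obtain Y where Y: "Y \<subseteq> X" "card Y = 5" using obtain_subset_with_card_n[OF assms(2)] by metis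
  have finY: "finite Y" using Y fin finite_subset by blast
  define cov where "cov c u \<longleftrightarrow> cell_sep c u (Y - u)" for c u
  define U where "U = {u. u \<subseteq> Y \<and> card u = 2}"
  define t where "t u = (LEAST i. i < length fs \<and> cov (fs ! i) u)" for u
  have t: "t u < length fs \<and> cov (fs ! t u) u" if "u \<in> U" for u
  proof -
    obtain m where "m \<in> C" "edge_count m = d" "cell_sep m u (Y - u)"
      using exists_splitting_facet[of u "Y - u"] \<open>u \<in> U\<close> Y by (auto simp: U_def)
    then have "m \<in> set fs" "cov m u" by (auto simp: fs_iff cov_def)
    then obtain i where "i < length fs \<and> cov (fs ! i) u" by (metis in_set_conv_nth)
    then show ?thesis unfolding t_def by (rule LeastI)
  qed
  have first: "\<not> cov (fs ! i) u" if "i < t u" "i < length fs" for i u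
    using not_less_Least[of i "\<lambda>i. i < length fs \<and> cov (fs ! i) u"] that unfolding t_def by blast
  have "finite U" using finY by (auto simp: U_def intro: finite_subset[of _ "Pow Y"])
  moreover have "U \<noteq> {}"
    using obtain_subset_with_card_n[of 2 Y] Y(2) unfolding U_def by auto
  ultimately have "Max (t ` U) \<in> t ` U" by (intro Max_in) auto
  then obtain u where u: "u \<in> U" "t u = Max (t ` U)" by fastforce
  have last: "t v \<le> t u" if "v \<in> U" for v
    using that u(2) \<open>finite U\<close> by simp
  define j where "j = t u"
  have j: "j < length fs" "cov (fs ! j) u" using t[OF u(1)] by (auto simp: j_def)
  have fsC: "fs ! i \<in> C" "edge_count (fs ! i) = d" if "i < length fs" for i
    using fs_iff nth_mem[OF that] by auto
  obtain a b where ab: "u = {a, b}" "a \<noteq> b" using u(1) by (auto simp: U_def card_2_iff)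
  have abY: "a \<in> Y" "b \<in> Y" using u(1) ab by (auto simp: U_def)
  have covered: "cov (fs ! j) {p, q}"
    if pqr: "Y = {a, b, p, q, r}" "distinct [a, b, p, q, r]" for p q r
  proof (rule ccontr)
    assume ncov: "\<not> cov (fs ! j) {p, q}"
    let ?v = "{p, q}"
    have vU: "?v \<in> U" using pqr by (auto simp: U_def)
    have memX: "a \<in> X" "b \<in> X" "p \<in> X" "q \<in> X" "r \<in> X" using pqr(1) Y(1) by auto
    have sub: "{a, b} \<subseteq> X" "{p, q} \<subseteq> X" using memX by auto
    have Yu: "Y - u = {p, q, r}" and Yv: "Y - ?v = {a, b, r}" using pqr ab by auto
    define i where "i = t ?v"
    have i: "i < length fs" "cov (fs ! i) ?v" using t[OF vU] by (auto simp: i_def)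
    have "i \<le> j" using last[OF vU] by (simp add: i_def j_def)
    moreover have "i \<noteq> j" using i ncov by auto
    ultimately have ij: "i < j" by simp
    have sj: "cell_sep (fs ! j) {a, b} {p, q}"
      using j(2) unfolding cov_def Yu by (rule cell_sep_mono) (auto simp: ab)
    have "cell_sep (fs ! i) {p, q} {a, b}"
      using i(2) unfolding cov_def Yv by (rule cell_sep_mono) auto
    then have si: "cell_sep (fs ! i) {a, b} {p, q}" by (rule cell_sep_sym)
    have dist: "distinct [a, b, p, q]" using pqr(2) by simp
    obtain z where z: "z \<in> C" "edge_count z = 0" "cell_sep z {a, b} {p, q}"
      "\<And>T. is_X_forest X T \<Longrightarrow> spread X T \<Longrightarrow> sep T {a, b} {p, q} \<Longrightarrow> ?le z (cls X T)"
      using zero_cell_below[OF fin memX(1-4) dist] by blast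
    have zb: "z \<in> bdry C ?le (fs ! k)" if k: "k < length fs" "cell_sep (fs ! k) {a, b} {p, q}" for k
    proof -
      obtain T where T: "is_X_forest X T" "fs ! k = cls X T" "spread X T"
        using facet_rep[OF fsC[OF k(1)]] .
      have Tk: "T \<in> fs ! k" unfolding T(2) by (rule cls_self)
      have "sep T {a, b} {p, q}" using cell_sep_rep[OF fsC(1)[OF k(1)] Tk sub k(2)] .
      then have "?le z (fs ! k)" unfolding T(2) by (rule z(4)[OF T(1,3)])
      moreover have "z \<noteq> fs ! k" using z(2) fsC(2)[OF k(1)] d by auto
      ultimately show ?thesis using z(1) by (simp add: bdry_def)
    qed
    have zK: "z \<in> K j" unfolding K_def using zb[OF j(1) sj] zb[OF i(1) si] ij by blast
    have KC: "K j \<subseteq> C" unfolding K_def bdry_def by blast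
    obtain m where m: "m \<in> K j" "\<forall>g\<in>K j. ?le m g \<longrightarrow> g = m"
      "\<forall>P Q. P \<subseteq> X \<longrightarrow> Q \<subseteq> X \<longrightarrow> cell_sep z P Q \<longrightarrow> cell_sep m P Q"
      using maximal_above[OF fin KC zK] by metis
    have mC: "m \<in> C" using m(1) KC by blast
    have "pure_dim C ?le (K j) d'" using K ij j(1) by simp
    then have "cell_dim C ?le m = d'" using m(1,2) unfolding pure_dim_def by metis
    then have ecm: "edge_count m = d'" using cell_dim_eq[OF mC] by simp
    obtain G where G: "is_X_forest X G" "m = cls X G" using mC by (auto simp: tuffley_poset_cls)
    have Gm: "G \<in> m" unfolding G(2) by (rule cls_self)
    have wfG: "wf_rep X G" using G(1) by (rule is_X_forest_wf)
    have "Suc (card (fedges G)) = d" using ecm d G(2) edge_count_cls[OF wfG] by simp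
    then have conn: "conn_set G (fverts G)" using ridge_connected[OF G(1)] by blast
    have "cell_sep m {a, b} {p, q}" using m(3) z(3) sub by simp
    from cell_sep_rep[OF mC Gm sub this] have "sep G {r, a, b} {p, q} \<or> sep G {a, b} {r, p, q}"
      using sep_insert[OF wfG conn _ _ _ memX(5)] by simp
    then show False
    proof
      assume "sep G {r, a, b} {p, q}"
      then have "cell_sep m {p, q} {r, a, b}" using Gm sep_sym unfolding cell_sep_def by blast
      moreover have "{r, a, b} = Y - ?v" using Yv by auto
      ultimately have "cell_sep m ?v (Y - ?v)" by simp
      moreover have "?le m (fs ! j)" using m(1) unfolding K_def bdry_def by blast
      ultimately have "cell_sep (fs ! j) ?v (Y - ?v)"
        using tuffley_le_cell_sep[OF fsC(1)[OF j(1)] mC] memX Yv by simp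
      then show False using ncov by (simp add: cov_def)
    next
      assume "sep G {a, b} {r, p, q}"
      then have "cell_sep m {a, b} {r, p, q}" using Gm unfolding cell_sep_def by blast
      moreover have "{r, p, q} = Y - u" using Yu by auto
      ultimately have s: "cell_sep m u (Y - u)" using ab by simp
      obtain k where k: "k < j" "?le m (fs ! k)" using m(1) unfolding K_def bdry_def by blast
      have kl: "k < length fs" using k(1) j(1) by simp
      have "cell_sep (fs ! k) u (Y - u)"
        using tuffley_le_cell_sep[OF fsC(1)[OF kl] mC k(2) _ _ s] memX Yu ab by simp
      then show False using first[of k u] k(1) kl by (simp add: cov_def j_def)
    qed
  qed
  have "finite u" using ab by simp
  then have "card (Y - u) = 3" using Y(2) u(1) card_Diff_subset[of u Y] by (simp add: U_def)
  then obtain p q r where pqr: "Y - u = {p, q, r}" "p \<noteq> q" "q \<noteq> r" "p \<noteq> r"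
    by (auto simp: card_3_iff)
  have Yeq: "Y = {a, b, p, q, r}" using pqr(1) ab abY by auto
  have "{p, q, r} \<inter> {a, b} = {}" using pqr(1) ab by blast
  then have dist: "distinct [a, b, p, q, r]" using pqr ab by auto
  have "cov (fs ! j) {p, q}" using covered[OF Yeq dist] .
  moreover have "cov (fs ! j) {q, r}" using covered[of q r p] Yeq dist by auto
  ultimately show False
    using facet_cherry_compatible[OF fsC[OF j(1)] Y(1), of p q r a] Yeq dist by (auto simp: cov_def)
qed

end
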